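(* There exists an algorithm which, given a finite alphabet $X$ with at least two letters and a bounded automaton $A$ over $X$, decides whether the group $G_A$ is level-transitive.
   Context: A finite automaton over a finite alphabet $X$ ($|X|\ge 2$) is a tuple $A=(S,X,\pi)$ with $S$ a finite set of states and $\pi:S\times X\to X\times S$; write $s\xrightarrow{x|y}t$ when $\pi(s,x)=(y,t)$. Each state $s$ defines a length-preserving transformation of $X^*$: $s(x_1\ldots x_n)=y_1\ldots y_n$ if there is a path $s=s_1\xrightarrow{x_1|y_1}s_2\xrightarrow{x_2|y_2}\cdots\xrightarrow{x_n|y_n}s_{n+1}$; the final state $s_{n+1}$ is the section $s|_v$ of $s$ at $v=x_1\ldots x_n$. All automata are assumed minimal, i.e. different states define different transformations, and states are identified with the transformations they define; $e$ denotes the identity transformation (the trivial state). $A$ is invertible if every state defines an invertible transformation; then the automaton group $G_A$ is the group generated under composition by the transformations defined by the states of $A$. An invertible finite automaton $A$ is bounded if there is a constant $C$ such that $|\{v\in X^n : s|_v\neq e\}|\le C$ for all $n\in\mathbb{N}$ and all states $s$ of $A$. The group $G_A$ is level-transitive if for every $n\ge 0$ the action of $G_A$ on $X^n$ has only one orbit. *)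

theory Defs
  imports "HOL-Algebra.Group_Action" "HOL-Algebra.Elementary_Groups" "HOL-Library.Nat_Bijection"
begin

section \<open>Finite automata and automaton groups\<close>

record ('s, 'x) automaton =
  states :: "'s set"
  letters :: "'x set"
  trans :: "'s \<times> 'x \<Rightarrow> 'x \<times> 's"

definition finite_automaton :: "('s, 'x) automaton \<Rightarrow> bool" where
  "finite_automaton A \<longleftrightarrow>
     finite (states A) \<and> finite (letters A) \<and> card (letters A) \<ge> 2 \<and>
     (\<forall>s\<in>states A. \<forall>x\<in>letters A. trans A (s, x) \<in> letters A \<times> states A)"

definition words :: "('s, 'x) automaton \<Rightarrow> 'x list set" where
  "words A = lists (letters A)"

definition words_of_length :: "('s, 'x) automaton \<Rightarrow> nat \<Rightarrow> 'x list set" where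
  "words_of_length A n = {v \<in> words A. length v = n}"

fun transform :: "('s, 'x) automaton \<Rightarrow> 's \<Rightarrow> 'x list \<Rightarrow> 'x list" where
  "transform A s [] = []"
| "transform A s (x # v) = (let (y, t) = trans A (s, x) in y # transform A t v)"

fun section_at :: "('s, 'x) automaton \<Rightarrow> 's \<Rightarrow> 'x list \<Rightarrow> 's" where
  "section_at A s [] = s"
| "section_at A s (x # v) = (let (y, t) = trans A (s, x) in section_at A t v)"

definition state_map :: "('s, 'x) automaton \<Rightarrow> 's \<Rightarrow> 'x list \<Rightarrow> 'x list" where
  "state_map A s = restrict (transform A s) (words A)"

definition minimal :: "('s, 'x) automaton \<Rightarrow> bool" where
  "minimal A \<longleftrightarrow> inj_on (state_map A) (states A)"

definition invertible :: "('s, 'x) automaton \<Rightarrow> bool" where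
  "invertible A \<longleftrightarrow> (\<forall>s\<in>states A. bij_betw (state_map A s) (words A) (words A))"

definition trivial_state :: "('s, 'x) automaton \<Rightarrow> 's \<Rightarrow> bool" where
  "trivial_state A s \<longleftrightarrow> (\<forall>v\<in>words A. state_map A s v = v)"

definition bounded_automaton :: "('s, 'x) automaton \<Rightarrow> bool" where
  "bounded_automaton A \<longleftrightarrow>
     finite_automaton A \<and> minimal A \<and> invertible A \<and>
     (\<exists>C::nat. \<forall>n. \<forall>s\<in>states A.
        card {v \<in> words_of_length A n. \<not> trivial_state A (section_at A s v)} \<le> C)"

definition automaton_group :: "('s, 'x) automaton \<Rightarrow> ('x list \<Rightarrow> 'x list) monoid" where
  "automaton_group A = subgroup_generated (BijGroup (words A)) (state_map A ` states A)"

definition level_transitive :: "('s, 'x) automaton \<Rightarrow> bool" where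
  "level_transitive A \<longleftrightarrow>
     (\<forall>n. card (orbits (automaton_group A) (words_of_length A n)
                  (\<lambda>g. restrict g (words_of_length A n))) = 1)"

section \<open>Algorithms: partial recursive functions\<close>

datatype prog =
    Zero
  | Succ
  | Proj nat
  | Comp prog "prog list"
  | PrimRec prog prog
  | Minimize prog

text \<open>
  Kleene's schemes, on argument lists; \<open>None\<close> means divergence (or a wrong number of
  arguments). For fixed \<open>n\<close>, the functions that programs define on lists of length \<open>n\<close> are
  exactly the \<open>n\<close>-ary partial recursive functions.
\<close>

fun run :: "prog \<Rightarrow> nat list \<Rightarrow> nat option" where
  "run Zero xs = Some 0"
| "run Succ xs = (case xs of [x] \<Rightarrow> Some (Suc x) | _ \<Rightarrow> None)"
| "run (Proj i) xs = (if i < length xs then Some (xs ! i) else None)"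
| "run (Comp f gs) xs =
     (let ys = map (\<lambda>g. run g xs) gs
      in if None \<in> set ys then None else run f (map the ys))"
| "run (PrimRec f g) xs =
     (case xs of
        [] \<Rightarrow> None
      | n # zs \<Rightarrow>
          rec_nat (run f zs) (\<lambda>i r. Option.bind r (\<lambda>y. run g (i # y # zs))) n)"
| "run (Minimize f) xs =
     (if \<exists>n. run f (n # xs) = Some 0 \<and> (\<forall>i<n. run f (i # xs) \<noteq> None)
      then Some (LEAST n. run f (n # xs) = Some 0)
      else None)"

text \<open>
  The input describing an automaton with letters \<open>{..<k}\<close> and states \<open>{..<m}\<close>: the numbers \<open>k\<close>
  and \<open>m\<close> together with the transition table, whose entry for \<open>(s, x)\<close> has index \<open>s * k + x\<close>.
\<close>

definition automaton_input :: "nat \<Rightarrow> nat \<Rightarrow> (nat, nat) automaton \<Rightarrow> nat list" where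
  "automaton_input k m A =
     [k, m, list_encode
        (concat (map (\<lambda>s. map (\<lambda>x. prod_encode (trans A (s, x))) [0..<k]) [0..<m]))]"

end

theory Submission
  imports Defs
begin

text \<open>
  The group is level-transitive iff for every \<open>n\<close> each two-colouring of \<open>X\<^sup>n\<close> that is
  invariant under all states is constant. Split invariance into the conditions \<open>f(s(v)) = f(v)\<close>
  with \<open>s|\<^sub>v\<close> trivial (the tile conditions) and those at the ports \<open>(s, v)\<close>, where \<open>s|\<^sub>v\<close>
  is nontrivial. A colouring of \<open>X\<^sup>n\<^sup>+\<^sup>1\<close> satisfies the tile conditions iff its restrictions to the
  subsets \<open>X\<^sup>n x\<close> do and some further equations between values at the ports of level \<open>n\<close> hold.
  So the set of possible patterns of port values, together with the information which of them come
  from constant colourings, determines the same data at the next level.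

  In a bounded automaton every cycle of nontrivial states is left only towards finitary states, hence
  a word with nontrivial section is determined by its first and last \<open>m\<close> letters, where \<open>m\<close> is the
  number of states. This bounds the number of ports, and with it the number of possible data,
  by a computable function \<open>N\<close> of the sizes of the alphabet and the state set. By the pigeonhole
  principle the data at every level already occur at some level up to \<open>N\<close>, so it suffices to
  inspect all two-colourings of \<open>X\<^sup>N\<close>.
\<close>

subsection \<open>Computable functions\<close>

text \<open>The restriction to argument lists of length \<open>n\<close> keeps bodies such as
  \<open>xs ! i\<close> meaningful. Totality there is attainable, since the searches below have
  guaranteed witnesses.\<close>

definition computable :: "nat \<Rightarrow> (nat list \<Rightarrow> nat) \<Rightarrow> bool" where
  "computable n f \<longleftrightarrow> (\<exists>p. \<forall>xs. length xs = n \<longrightarrow> run p xs = Some (f xs))"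

lemma computable_cong:
  assumes "computable n f" "\<And>xs. length xs = n \<Longrightarrow> f xs = g xs"
  shows "computable n g"
  using assms unfolding computable_def by metis

lemma computable_compose:
  assumes f: "computable (length gs) f" and gs: "\<And>g. g \<in> set gs \<Longrightarrow> computable n g"
  shows "computable n (\<lambda>xs. f (map (\<lambda>g. g xs) gs))"
proof -
  obtain pf where pf: "\<And>xs. length xs = length gs \<Longrightarrow> run pf xs = Some (f xs)"
    using f unfolding computable_def by auto
  have "\<forall>g\<in>set gs. \<exists>p. \<forall>xs. length xs = n \<longrightarrow> run p xs = Some (g xs)"
    using gs unfolding computable_def by blast
  then obtain P where P: "\<And>g xs. g \<in> set gs \<Longrightarrow> length xs = n \<Longrightarrow> run (P g) xs = Some (g xs)"
    by metis
  have "run (Comp pf (map P gs)) xs = Some (f (map (\<lambda>g. g xs) gs))" if "length xs = n" for xs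
  proof -
    have *: "map (\<lambda>g. run g xs) (map P gs) = map (\<lambda>g. Some (g xs)) gs"
      using P that by auto
    have "run (Comp pf (map P gs)) xs = run pf (map the (map (\<lambda>g. Some (g xs)) gs))"
      unfolding run.simps Let_def * by auto
    also have "\<dots> = Some (f (map (\<lambda>g. g xs) gs))"
      by (simp add: pf comp_def)
    finally show ?thesis .
  qed
  then show ?thesis unfolding computable_def by blast
qed

lemma computable_nth: "i < n \<Longrightarrow> computable n (\<lambda>xs. xs ! i)"
  unfolding computable_def by (intro exI[of _ "Proj i"]) auto

text \<open>Quantifiers and recursions put their own variables in front of the parameters, which are
  then reached through one or two \<open>tl\<close>.\<close>

lemma computable_nth_tl: "Suc i < n \<Longrightarrow> computable n (\<lambda>xs. tl xs ! i)"
  by (rule computable_cong[OF computable_nth[of "Suc i"]]) (auto simp: nth_tl)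

lemma computable_nth_tl_tl: "Suc (Suc i) < n \<Longrightarrow> computable n (\<lambda>xs. tl (tl xs) ! i)"
  by (rule computable_cong[OF computable_nth[of "Suc (Suc i)"]]) (auto simp: nth_tl)

lemma computable_compose1:
  assumes "computable 1 (\<lambda>xs. F (xs ! 0))" "computable n a"
  shows "computable n (\<lambda>xs. F (a xs))"
  using computable_compose[of "[a]" "\<lambda>xs. F (xs ! 0)" n] assms by simp

lemma computable_compose2:
  assumes "computable 2 (\<lambda>xs. F (xs ! 0) (xs ! 1))" "computable n a" "computable n b"
  shows "computable n (\<lambda>xs. F (a xs) (b xs))"
  using computable_compose[of "[a, b]" "\<lambda>xs. F (xs ! 0) (xs ! 1)" n] assms
  by (auto simp: numeral_eq_Suc)

lemma computable_compose4:
  assumes "computable 4 (\<lambda>xs. F (xs ! 0) (xs ! 1) (xs ! 2) (xs ! 3))"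
    and "computable n a" "computable n b" "computable n c" "computable n d"
  shows "computable n (\<lambda>xs. F (a xs) (b xs) (c xs) (d xs))"
  using computable_compose[of "[a, b, c, d]" "\<lambda>xs. F (xs ! 0) (xs ! 1) (xs ! 2) (xs ! 3)" n] assms
  by (auto simp: numeral_eq_Suc)

lemma computable_compose5:
  assumes "computable 5 (\<lambda>xs. F (xs ! 0) (xs ! 1) (xs ! 2) (xs ! 3) (xs ! 4))"
    and "computable n a" "computable n b" "computable n c" "computable n d" "computable n e"
  shows "computable n (\<lambda>xs. F (a xs) (b xs) (c xs) (d xs) (e xs))"
  using computable_compose[of "[a, b, c, d, e]"
      "\<lambda>xs. F (xs ! 0) (xs ! 1) (xs ! 2) (xs ! 3) (xs ! 4)" n] assms
  by (auto simp: numeral_eq_Suc)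

lemma computable_compose6:
  assumes "computable 6 (\<lambda>xs. F (xs ! 0) (xs ! 1) (xs ! 2) (xs ! 3) (xs ! 4) (xs ! 5))"
    and "computable n a" "computable n b" "computable n c" "computable n d" "computable n e"
      "computable n f"
  shows "computable n (\<lambda>xs. F (a xs) (b xs) (c xs) (d xs) (e xs) (f xs))"
  using computable_compose[of "[a, b, c, d, e, f]"
      "\<lambda>xs. F (xs ! 0) (xs ! 1) (xs ! 2) (xs ! 3) (xs ! 4) (xs ! 5)" n] assms
  by (auto simp: numeral_eq_Suc)

lemma computable_Suc: "computable n a \<Longrightarrow> computable n (\<lambda>xs. Suc (a xs))"
proof (rule computable_compose1[of Suc])
  show "computable 1 (\<lambda>xs. Suc (xs ! 0))"
    unfolding computable_def by (intro exI[of _ Succ]) (auto simp: length_Suc_conv)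
qed

lemma computable_const: "computable n (\<lambda>xs. c)"
proof (induction c)
  case 0
  show ?case unfolding computable_def by (intro exI[of _ Zero]) auto
next
  case (Suc c)
  then show ?case by (rule computable_Suc)
qed

lemma computable_rec:
  assumes f: "computable n f"
    and g: "computable (Suc (Suc n)) (\<lambda>ys. G (ys ! 0) (ys ! 1) (tl (tl ys)))"
    and b: "computable n b"
  shows "computable n (\<lambda>xs. rec_nat (f xs) (\<lambda>i r. G i r xs) (b xs))"
proof -
  obtain pf where pf: "\<And>xs. length xs = n \<Longrightarrow> run pf xs = Some (f xs)"
    using f unfolding computable_def by auto
  obtain pg where pg: "\<And>ys. length ys = Suc (Suc n) \<Longrightarrow>
      run pg ys = Some (G (ys ! 0) (ys ! 1) (tl (tl ys)))"
    using g unfolding computable_def by auto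
  define h where "h ys = rec_nat (f (tl ys)) (\<lambda>i r. G i r (tl ys)) (hd ys)" for ys
  have "run (PrimRec pf pg) ys = Some (h ys)" if len: "length ys = Suc n" for ys
  proof -
    obtain j xs where ys: "ys = j # xs" and xs: "length xs = n"
      using len by (auto simp: length_Suc_conv)
    have "rec_nat (run pf xs) (\<lambda>i r. Option.bind r (\<lambda>y. run pg (i # y # xs))) j =
        Some (rec_nat (f xs) (\<lambda>i r. G i r xs) j)"
      by (induction j) (simp_all add: pf pg xs)
    then show ?thesis by (simp add: ys h_def)
  qed
  then have h: "computable (Suc n) h" unfolding computable_def by blast
  \<comment> \<open>\<open>PrimRec\<close> recurses on its first argument, so \<open>h\<close> takes
    the bound in front; the projections hand on the original arguments behind it.\<close>
  let ?gs = "b # map (\<lambda>i xs. xs ! i) [0..<n]"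
  have "computable n (\<lambda>xs. h (map (\<lambda>g. g xs) ?gs))"
    by (rule computable_compose) (use h b in \<open>auto intro: computable_nth\<close>)
  then show ?thesis
  proof (rule computable_cong)
    fix xs :: "nat list" assume "length xs = n"
    then have "map (\<lambda>g. g xs) ?gs = b xs # xs"
      by (auto simp: comp_def intro: nth_equalityI)
    then show "h (map (\<lambda>g. g xs) ?gs) = rec_nat (f xs) (\<lambda>i r. G i r xs) (b xs)"
      by (simp add: h_def)
  qed
qed

text \<open>\<open>Minimize\<close> looks for a zero, hence the negation: the value is 0 exactly
  where \<open>P\<close> holds. A witness makes the search halt.\<close>

lemma computable_Least:
  assumes g: "computable (Suc n) (\<lambda>ys. of_bool (\<not> P (ys ! 0) (tl ys)))"
    and ex: "\<And>xs. length xs = n \<Longrightarrow> \<exists>i. P i xs"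
  shows "computable n (\<lambda>xs. LEAST i. P i xs)"
proof -
  obtain p where p: "\<And>ys. length ys = Suc n \<Longrightarrow>
      run p ys = Some (of_bool (\<not> P (ys ! 0) (tl ys)))"
    using g unfolding computable_def by auto
  have "run (Minimize p) xs = Some (LEAST i. P i xs)" if "length xs = n" for xs
    using ex[OF that] by (simp add: p that)
  then show ?thesis unfolding computable_def by blast
qed

lemmas computable_basic =
  computable_nth computable_nth_tl computable_nth_tl_tl computable_Suc computable_const

section \<open>Arithmetic, logical connectives and bounded quantifiers\<close>

lemma computable_add:
  assumes "computable n a" "computable n b"
  shows "computable n (\<lambda>xs. a xs + b xs)"
proof (rule computable_compose2[of "(+)", OF _ assms])
  have "rec_nat a (\<lambda>i r. Suc r) b = a + b" for a b :: nat
    by (induction b) auto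
  then show "computable 2 (\<lambda>xs. xs ! 0 + xs ! 1)"
    using computable_rec[of 2 "\<lambda>xs. xs ! 0" "\<lambda>i r xs. Suc r" "\<lambda>xs. xs ! 1"]
    by (simp add: computable_basic)
qed

lemma computable_mult:
  assumes "computable n a" "computable n b"
  shows "computable n (\<lambda>xs. a xs * b xs)"
proof (rule computable_compose2[of "(*)", OF _ assms])
  have "rec_nat 0 (\<lambda>i r. r + a) b = a * b" for a b :: nat
    by (induction b) auto
  then show "computable 2 (\<lambda>xs. xs ! 0 * xs ! 1)"
    using computable_rec[of 2 "\<lambda>xs. 0" "\<lambda>i r xs. r + xs ! 0" "\<lambda>xs. xs ! 1"]
    by (simp add: computable_basic computable_add)
qed

lemma computable_power:
  assumes "computable n a" "computable n b"
  shows "computable n (\<lambda>xs. a xs ^ b xs)"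
proof (rule computable_compose2[of "(^)", OF _ assms])
  have "rec_nat 1 (\<lambda>i r. r * a) b = a ^ b" for a b :: nat
    by (induction b) auto
  then show "computable 2 (\<lambda>xs. xs ! 0 ^ xs ! 1)"
    using computable_rec[of 2 "\<lambda>xs. 1" "\<lambda>i r xs. r * xs ! 0" "\<lambda>xs. xs ! 1"]
    by (simp add: computable_basic computable_mult)
qed

lemma computable_pred:
  assumes "computable n a"
  shows "computable n (\<lambda>xs. a xs - 1)"
proof (rule computable_compose1[of "\<lambda>x. x - 1", OF _ assms])
  have "rec_nat 0 (\<lambda>i r. i) b = b - 1" for b :: nat
    by (cases b) auto
  then show "computable 1 (\<lambda>xs. xs ! 0 - 1)"
    using computable_rec[of 1 "\<lambda>xs. 0" "\<lambda>i r xs. i" "\<lambda>xs. xs ! 0"]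
    by (simp add: computable_basic)
qed

lemma computable_diff:
  assumes "computable n a" "computable n b"
  shows "computable n (\<lambda>xs. a xs - b xs)"
proof (rule computable_compose2[of "(-)", OF _ assms])
  have "rec_nat a (\<lambda>i r. r - 1) b = a - b" for a b :: nat
    by (induction b) auto
  then show "computable 2 (\<lambda>xs. xs ! 0 - xs ! 1)"
    using computable_rec[of 2 "\<lambda>xs. xs ! 0" "\<lambda>i r xs. r - 1" "\<lambda>xs. xs ! 1"]
    by (simp add: computable_basic computable_pred[simplified])
qed

lemma computable_Not:
  assumes "computable n (\<lambda>xs. of_bool (P xs))"
  shows "computable n (\<lambda>xs. of_bool (\<not> P xs))"
  by (rule computable_cong[OF computable_diff[OF computable_const[of _ 1] assms]]) auto

lemma computable_conj:
  assumes "computable n (\<lambda>xs. of_bool (P xs))" "computable n (\<lambda>xs. of_bool (Q xs))"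
  shows "computable n (\<lambda>xs. of_bool (P xs \<and> Q xs))"
  by (rule computable_cong[OF computable_mult[OF assms]]) auto

lemma computable_imp:
  assumes "computable n (\<lambda>xs. of_bool (P xs))" "computable n (\<lambda>xs. of_bool (Q xs))"
  shows "computable n (\<lambda>xs. of_bool (P xs \<longrightarrow> Q xs))"
  using computable_Not[OF computable_conj[OF assms(1) computable_Not[OF assms(2)]]] by simp

lemma computable_eq:
  assumes "computable n a" "computable n b"
  shows "computable n (\<lambda>xs. of_bool (a xs = b xs))"
proof -
  have "computable n (\<lambda>xs. 1 - ((a xs - b xs) + (b xs - a xs)))"
    by (intro computable_diff computable_add computable_const assms)
  then show ?thesis by (rule computable_cong) auto
qed

lemma computable_if:
  assumes "computable n (\<lambda>xs. of_bool (P xs))" "computable n a" "computable n b"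
  shows "computable n (\<lambda>xs. if P xs then a xs else b xs)"
proof -
  have "computable n (\<lambda>xs. of_bool (P xs) * a xs + of_bool (\<not> P xs) * b xs)"
    by (intro computable_add computable_mult computable_Not assms)
  then show ?thesis by (rule computable_cong) auto
qed

lemma computable_all_less:
  assumes "computable (Suc n) (\<lambda>ys. of_bool (P (ys ! 0) (tl ys)))" "computable n b"
  shows "computable n (\<lambda>xs. of_bool (\<forall>i<b xs. P i xs))"
proof -
  have P: "computable (Suc (Suc n)) (\<lambda>ys. of_bool (P (ys ! 0) (tl (tl ys))))"
  proof -
    \<comment> \<open>The recursion step sees counter, accumulator and parameters; these projections
      drop the accumulator.\<close>
    let ?gs = "(\<lambda>ys. ys ! 0) # map (\<lambda>i ys. ys ! Suc (Suc i)) [0..<n]"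
    have "computable (Suc (Suc n))
        (\<lambda>ys. (\<lambda>ys. of_bool (P (ys ! 0) (tl ys))) (map (\<lambda>g. g ys) ?gs))"
      by (rule computable_compose) (use assms in \<open>auto intro: computable_nth\<close>)
    then show ?thesis
    proof (rule computable_cong)
      fix ys :: "nat list" assume "length ys = Suc (Suc n)"
      then have "map (\<lambda>g. g ys) ?gs = ys ! 0 # tl (tl ys)"
        by (auto simp: comp_def nth_tl intro!: nth_equalityI)
      then show "of_bool (P (map (\<lambda>g. g ys) ?gs ! 0) (tl (map (\<lambda>g. g ys) ?gs))) =
          (of_bool (P (ys ! 0) (tl (tl ys))) :: nat)"
        by simp
    qed
  qed
  have "rec_nat 1 (\<lambda>i r. r * of_bool (P i xs)) m = (of_bool (\<forall>i<m. P i xs) :: nat)" for m xs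
    by (induction m) (auto simp: less_Suc_eq)
  then show ?thesis
    using computable_rec[of n "\<lambda>xs. 1" "\<lambda>i r xs. r * of_bool (P i xs)" b] P assms(2)
    by (simp add: computable_basic computable_mult)
qed

lemma computable_ex_less:
  assumes "computable (Suc n) (\<lambda>ys. of_bool (P (ys ! 0) (tl ys)))" "computable n b"
  shows "computable n (\<lambda>xs. of_bool (\<exists>i<b xs. P i xs))"
  using computable_Not[OF computable_all_less[OF computable_Not[OF assms(1)] assms(2)]] by simp

lemma computable_mod:
  assumes "computable n a" "computable n b"
  shows "computable n (\<lambda>xs. a xs mod b xs)"
proof (rule computable_compose2[of "(mod)", OF _ assms])
  \<comment> \<open>A counter that is reset on reaching \<open>b\<close>; for \<open>b = 0\<close>
    it is never reset, matching \<open>a mod 0 = a\<close>.\<close>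
  have "rec_nat 0 (\<lambda>i r. if Suc r = b then 0 else Suc r) a = a mod b" for a b :: nat
    by (induction a) (auto simp: mod_Suc)
  then show "computable 2 (\<lambda>xs. xs ! 0 mod xs ! 1)"
    using computable_rec[of 2 "\<lambda>xs. 0" "\<lambda>i r xs. if Suc r = xs ! 1 then 0 else Suc r" "\<lambda>xs. xs ! 0"]
    by (simp add: computable_basic computable_if computable_eq)
qed

lemma computable_div:
  assumes "computable n a" "computable n b"
  shows "computable n (\<lambda>xs. a xs div b xs)"
proof (rule computable_compose2[of "(div)", OF _ assms])
  \<comment> \<open>This counts the multiples of \<open>b\<close> among 1, ...,
    \<open>a\<close>.\<close>
  have "rec_nat 0 (\<lambda>i r. if Suc i mod b = 0 then Suc r else r) a = a div b" if "b \<noteq> 0" for a b :: nat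
    by (induction a) (auto simp: div_Suc mod_Suc that split: if_splits)
  then have *: "(if b = 0 then 0 else rec_nat 0 (\<lambda>i r. if Suc i mod b = 0 then Suc r else r) a)
      = a div b" for a b :: nat by simp
  have "computable 2 (\<lambda>xs. if xs ! 1 = 0 then 0 else
      rec_nat 0 (\<lambda>i r. if Suc i mod xs ! 1 = 0 then Suc r else r) (xs ! 0))"
    by (intro computable_if computable_eq computable_basic computable_rec computable_mod) auto
  then show "computable 2 (\<lambda>xs. xs ! 0 div xs ! 1)"
    by (simp only: *)
qed

lemmas computable_arith = computable_basic computable_add computable_mult computable_power
  computable_diff computable_mod computable_div
  computable_eq computable_Not computable_conj computable_imp computable_if

section \<open>Decoding of pairs and lists\<close>

lemma prod_encode_arith: "prod_encode (a, b) = (a + b) * Suc (a + b) div 2 + a"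
  by (simp add: prod_encode_def triangle_def)

text \<open>Pairing is arithmetical and is inverted by search: the first component by minimization,
  the second below the code itself, which bounds it.\<close>

lemma computable_fst_prod_decode:
  assumes "computable n a"
  shows "computable n (\<lambda>xs. fst (prod_decode (a xs)))"
proof (rule computable_compose1[OF _ assms])
  have "fst (prod_decode z) = (LEAST i. \<exists>j<Suc z. prod_encode (i, j) = z)" for z
  proof (rule Least_equality[symmetric])
    have "snd (prod_decode z) < Suc z"
      using le_prod_encode_2[of "snd (prod_decode z)" "fst (prod_decode z)"] by simp
    then show "\<exists>j<Suc z. prod_encode (fst (prod_decode z), j) = z"
      by (metis prod.collapse prod_decode_inverse)
  next
    fix i assume "\<exists>j<Suc z. prod_encode (i, j) = z"
    then show "fst (prod_decode z) \<le> i" by auto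
  qed
  moreover have "computable 1 (\<lambda>xs. LEAST i. \<exists>j<Suc (xs ! 0). prod_encode (i, j) = xs ! 0)"
  proof (rule computable_Least)
    show "computable (Suc 1) (\<lambda>ys. of_bool
        (\<not> (\<exists>j<Suc (tl ys ! 0). prod_encode (ys ! 0, j) = tl ys ! 0)))"
      unfolding prod_encode_arith
      by (intro computable_arith computable_ex_less) auto
    fix xs :: "nat list"
    show "\<exists>i. \<exists>j<Suc (xs ! 0). prod_encode (i, j) = xs ! 0"
      by (metis le_imp_less_Suc le_prod_encode_2 prod.collapse prod_decode_inverse)
  qed
  ultimately show "computable 1 (\<lambda>xs. fst (prod_decode (xs ! 0)))" by simp
qed

lemma computable_snd_prod_decode:
  assumes "computable n a"
  shows "computable n (\<lambda>xs. snd (prod_decode (a xs)))"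
proof (rule computable_compose1[OF _ assms])
  have "snd (prod_decode z) = (LEAST j. prod_encode (fst (prod_decode z), j) = z)" for z
  proof (rule Least_equality[symmetric])
    show "prod_encode (fst (prod_decode z), snd (prod_decode z)) = z" by simp
    fix j assume "prod_encode (fst (prod_decode z), j) = z"
    then show "snd (prod_decode z) \<le> j" by (metis order_refl prod_encode_inverse snd_conv)
  qed
  moreover have
    "computable 1 (\<lambda>xs. LEAST j. prod_encode (fst (prod_decode (xs ! 0)), j) = xs ! 0)"
  proof (rule computable_Least)
    show "computable (Suc 1) (\<lambda>ys. of_bool
        (\<not> prod_encode (fst (prod_decode (tl ys ! 0)), ys ! 0) = tl ys ! 0))"
      unfolding prod_encode_arith
      by (intro computable_arith computable_fst_prod_decode) auto
    fix xs :: "nat list"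
    show "\<exists>j. prod_encode (fst (prod_decode (xs ! 0)), j) = xs ! 0"
      by (metis prod.collapse prod_decode_inverse)
  qed
  ultimately show "computable 1 (\<lambda>xs. snd (prod_decode (xs ! 0)))" by simp
qed

text \<open>\<open>list_encode (x # l)\<close> is the successor of the code of the pair of
  \<open>x\<close> and \<open>list_encode l\<close>. Each \<open>- 1\<close> undoes this successor;
  the recursion drops \<open>i\<close> entries and \<open>fst\<close> reads the next.\<close>

definition code_nth :: "nat \<Rightarrow> nat \<Rightarrow> nat" where
  "code_nth z i = fst (prod_decode (rec_nat z (\<lambda>_ r. snd (prod_decode (r - 1))) i - 1))"

lemma code_nth_list_encode:
  assumes "i < length l"
  shows "code_nth (list_encode l) i = l ! i"
proof -
  have "rec_nat (list_encode l) (\<lambda>_ r. snd (prod_decode (r - 1))) i = list_encode (drop i l)"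
    using assms
  proof (induction i)
    case (Suc i)
    then have "drop i l = l ! i # drop (Suc i) l" by (simp add: Cons_nth_drop_Suc)
    with Suc show ?case by simp
  qed simp
  moreover have "drop i l = l ! i # drop (Suc i) l"
    using assms by (simp add: Cons_nth_drop_Suc)
  ultimately show ?thesis by (simp add: code_nth_def)
qed

lemma computable_code_nth:
  assumes "computable n a" "computable n b"
  shows "computable n (\<lambda>xs. code_nth (a xs) (b xs))"
proof (rule computable_compose2[OF _ assms])
  show "computable 2 (\<lambda>xs. code_nth (xs ! 0) (xs ! 1))"
    unfolding code_nth_def
    by (intro computable_fst_prod_decode computable_diff computable_rec
        computable_snd_prod_decode computable_basic) auto
qed

subsection \<open>Words, sections and invariant colourings\<close>

lemma section_at_append:
  "section_at A s (u @ v) = section_at A (section_at A s u) v"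
  by (induction u arbitrary: s) (auto split: prod.split)

lemma transform_append:
  "transform A s (u @ v) = transform A s u @ transform A (section_at A s u) v"
  by (induction u arbitrary: s) (auto split: prod.split)

lemma length_transform [simp]: "length (transform A s v) = length v"
  by (induction v arbitrary: s) (auto split: prod.split)

lemma section_at_snoc: "section_at A s (v @ [x]) = snd (trans A (section_at A s v, x))"
  by (simp add: section_at_append split: prod.split)

lemma transform_snoc:
  "transform A s (v @ [x]) = transform A s v @ [fst (trans A (section_at A s v, x))]"
  by (simp add: transform_append split: prod.split)

lemma fst_trans_closed:
  assumes "finite_automaton A" "s \<in> states A" "x \<in> letters A"
  shows "fst (trans A (s, x)) \<in> letters A"
  using assms unfolding finite_automaton_def by (metis mem_Times_iff)

lemma section_at_closed:
  assumes "finite_automaton A" "s \<in> states A" "v \<in> words A"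
  shows "section_at A s v \<in> states A"
  using assms(3,2) unfolding words_def
  by (induction v arbitrary: s) (use assms(1) in \<open>fastforce simp: finite_automaton_def split: prod.split\<close>)+

lemma transform_closed:
  assumes "finite_automaton A" "s \<in> states A" "v \<in> words_of_length A n"
  shows "transform A s v \<in> words_of_length A n"
proof -
  have "transform A s v \<in> words A"
    using assms(3)[unfolded words_of_length_def words_def, simplified, THEN conjunct1] assms(2)
    unfolding words_def in_lists_conv_set[symmetric]
    by (induction v arbitrary: s)
      (use assms(1) in \<open>fastforce simp: finite_automaton_def split: prod.split\<close>)+
  with assms(3) show ?thesis by (auto simp: words_of_length_def)
qed

lemma words_of_length_Suc_iff:
  "v @ [x] \<in> words_of_length A (Suc n) \<longleftrightarrow> v \<in> words_of_length A n \<and> x \<in> letters A"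
  by (auto simp: words_of_length_def words_def)

lemma words_of_length_SucE:
  assumes "w \<in> words_of_length A (Suc n)"
  obtains v x where "w = v @ [x]" "v \<in> words_of_length A n" "x \<in> letters A"
  using assms by (cases w rule: rev_cases) (auto simp: words_of_length_def words_def)

lemma finite_words_of_length: "finite (letters A) \<Longrightarrow> finite (words_of_length A n)"
  using finite_lists_length_eq[of "letters A" n]
  by (auto simp: words_of_length_def words_def lists_eq_set elim: rev_finite_subset)

lemma card_words_of_length: "finite (letters A) \<Longrightarrow> card (words_of_length A n) = card (letters A) ^ n"
  using card_lists_length_eq[of "letters A" n]
  by (auto simp: words_of_length_def words_def lists_eq_set Collect_conj_eq)

text \<open>Invariant colourings replace orbits so that only the states occur, not their inverses
  and products; the condition can then be tested by a finite search.\<close>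

definition transitive_on_level :: "('s, 'x) automaton \<Rightarrow> nat \<Rightarrow> bool" where
  "transitive_on_level A n \<longleftrightarrow>
     (\<forall>f. (\<forall>s\<in>states A. \<forall>v\<in>words_of_length A n. f (transform A s v) = f v) \<longrightarrow>
          (\<forall>v\<in>words_of_length A n. f v) \<or> (\<forall>v\<in>words_of_length A n. \<not> f v))"

subsection \<open>Testing the colourings of a level\<close>

text \<open>
  The first letter is the least significant digit, so that appending a letter to a word does
  not move the digits of the word.
\<close>

definition word_of :: "nat \<Rightarrow> nat \<Rightarrow> nat \<Rightarrow> nat list" where
  "word_of k n v = map (\<lambda>j. v div k ^ j mod k) [0..<n]"

fun num_of :: "nat \<Rightarrow> nat list \<Rightarrow> nat" where
  "num_of k [] = 0"
| "num_of k (x # w) = x + k * num_of k w"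

lemma num_of_snoc: "num_of k (w @ [x]) = num_of k w + k ^ length w * x"
  by (induction w) (auto simp: algebra_simps)

lemma word_of_Suc: "word_of k (Suc n) v = word_of k n v @ [v div k ^ n mod k]"
  by (simp add: word_of_def)

lemma length_word_of [simp]: "length (word_of k n v) = n"
  by (simp add: word_of_def)

lemma word_of_Suc': "word_of k (Suc n) v = v mod k # word_of k n (v div k)"
proof -
  have "map (\<lambda>j. v div k ^ j mod k) [0..<Suc n] =
      v mod k # map (\<lambda>j. v div k ^ Suc j mod k) [0..<n]"
    unfolding upt_conv_Cons[OF zero_less_Suc] map_Suc_upt[symmetric] by simp
  then show ?thesis by (simp add: word_of_def div_mult2_eq)
qed

lemma num_of_word_of: "num_of k (word_of k n v) = v mod k ^ n"
proof (induction n)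
  case 0
  show ?case by (simp add: word_of_def)
next
  case (Suc n)
  then show ?case
    using mod_mult2_eq[of v "k ^ n" k] by (simp add: word_of_Suc num_of_snoc mult.commute)
qed

lemma word_of_num_of: "set w \<subseteq> {..<k} \<Longrightarrow> word_of k (length w) (num_of k w) = w"
proof (induction w)
  case Nil
  show ?case by (simp add: word_of_def)
next
  case (Cons x w)
  then show ?case by (simp add: word_of_Suc')
qed

lemma num_of_less: "set w \<subseteq> {..<k} \<Longrightarrow> num_of k w < k ^ length w"
proof (induction w)
  case (Cons x w)
  then have "x < k" "Suc (num_of k w) \<le> k ^ length w" by auto
  then have "x + k * num_of k w < k * Suc (num_of k w)" by simp
  also have "\<dots> \<le> k * k ^ length w"
    using \<open>Suc (num_of k w) \<le> k ^ length w\<close> by (rule mult_le_mono2)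
  finally show ?case by simp
qed simp

text \<open>Runs the automaton on the digits of \<open>v\<close> from the table code
  \<open>z\<close> alone: entry \<open>r * k + x\<close> holds output letter and next state, so
  \<open>snd\<close> advances the state.\<close>

definition run_section :: "nat \<Rightarrow> nat \<Rightarrow> nat \<Rightarrow> nat \<Rightarrow> nat \<Rightarrow> nat" where
  "run_section k z s v n =
     rec_nat s (\<lambda>j r. snd (prod_decode (code_nth z (r * k + v div k ^ j mod k)))) n"

definition run_transform :: "nat \<Rightarrow> nat \<Rightarrow> nat \<Rightarrow> nat \<Rightarrow> nat \<Rightarrow> nat" where
  "run_transform k z s v n =
     rec_nat 0 (\<lambda>j r. r + k ^ j *
       fst (prod_decode (code_nth z (run_section k z s v j * k + v div k ^ j mod k)))) n"

lemma computable_run_section: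
  assumes "computable n a" "computable n b" "computable n c" "computable n d" "computable n e"
  shows "computable n (\<lambda>xs. run_section (a xs) (b xs) (c xs) (d xs) (e xs))"
proof (rule computable_compose5[OF _ assms])
  show "computable 5 (\<lambda>xs. run_section (xs ! 0) (xs ! 1) (xs ! 2) (xs ! 3) (xs ! 4))"
    unfolding run_section_def
    by (intro computable_rec computable_arith computable_snd_prod_decode computable_code_nth) auto
qed

lemma computable_run_transform:
  assumes "computable n a" "computable n b" "computable n c" "computable n d" "computable n e"
  shows "computable n (\<lambda>xs. run_transform (a xs) (b xs) (c xs) (d xs) (e xs))"
proof (rule computable_compose5[OF _ assms])
  show "computable 5 (\<lambda>xs. run_transform (xs ! 0) (xs ! 1) (xs ! 2) (xs ! 3) (xs ! 4))"
    unfolding run_transform_def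
    by (intro computable_rec computable_arith computable_fst_prod_decode computable_code_nth
        computable_run_section) auto
qed

section \<open>Indexing of the flattened transition table\<close>

lemma table_index_less: "s < m \<Longrightarrow> x < k \<Longrightarrow> s * k + x < m * k" for s m x k :: nat
proof -
  assume "s < m" "x < k"
  then have "s * k + x < Suc s * k" by simp
  also have "\<dots> \<le> m * k" using \<open>s < m\<close> by (intro mult_le_mono1) simp
  finally show ?thesis .
qed

lemma length_concat_table: "length (concat (map (\<lambda>s. map (h s) [0..<k]) [0..<m])) = m * k"
  by (induction m) auto

lemma nth_concat_table:
  assumes "s < m" "x < k"
  shows "concat (map (\<lambda>s. map (h s) [0..<k]) [0..<m]) ! (s * k + x) = h s x"
  using assms(1)
proof (induction m)
  case (Suc m)
  then have "s < m \<or> s = m" by auto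
  then show ?case using Suc.IH assms(2) table_index_less[of s m x k]
    by (auto simp: nth_append length_concat_table)
qed simp

definition table_code :: "nat \<Rightarrow> nat \<Rightarrow> (nat, nat) automaton \<Rightarrow> nat" where
  "table_code k m A = list_encode
     (concat (map (\<lambda>s. map (\<lambda>x. prod_encode (trans A (s, x))) [0..<k]) [0..<m]))"

lemma code_nth_table_code:
  assumes "s < m" "x < k"
  shows "code_nth (table_code k m A) (s * k + x) = prod_encode (trans A (s, x))"
  unfolding table_code_def
  using nth_concat_table[OF assms, of "\<lambda>s x. prod_encode (trans A (s, x))"] table_index_less[OF assms]
  by (subst code_nth_list_encode) (simp_all only: length_concat_table)

text \<open>The binary digits of \<open>M\<close> form a two-colouring of the words of length \<open>n\<close>.\<close>

definition colouring_test :: "nat \<Rightarrow> nat \<Rightarrow> nat \<Rightarrow> nat \<Rightarrow> bool" where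
  "colouring_test k m z n \<longleftrightarrow>
     (\<forall>M<2 ^ (k ^ n) :: nat.
        (\<forall>v<k ^ n. \<forall>s<m. M div 2 ^ run_transform k z s v n mod 2 = M div 2 ^ v mod 2) \<longrightarrow>
        (\<forall>v<k ^ n. M div 2 ^ v mod 2 = M mod 2))"

context
  fixes A :: "(nat, nat) automaton" and k m :: nat
  assumes fin: "finite_automaton A" and letters: "letters A = {..<k}" and states: "states A = {..<m}"
begin

section \<open>Agreement of the coded run with the automaton\<close>

lemma word_of_in_words: "word_of k n v \<in> words_of_length A n"
proof -
  have "k > 0" using fin by (auto simp: finite_automaton_def letters)
  then show ?thesis
    by (auto simp: words_of_length_def words_def letters word_of_def)
qed

lemma run_section_eq:
  assumes "s < m"
  shows "run_section k (table_code k m A) s v n = section_at A s (word_of k n v)"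
proof (induction n)
  case 0
  show ?case by (simp add: run_section_def word_of_def)
next
  case (Suc n)
  have "section_at A s (word_of k n v) < m"
    using section_at_closed[OF fin, of s "word_of k n v"] assms word_of_in_words
    by (simp add: states words_of_length_def)
  moreover have "v div k ^ n mod k < k"
    using fin by (auto simp: finite_automaton_def letters)
  ultimately show ?case
    using Suc by (simp add: run_section_def word_of_Suc section_at_snoc code_nth_table_code)
qed

lemma run_transform_eq:
  assumes "s < m"
  shows "run_transform k (table_code k m A) s v n = num_of k (transform A s (word_of k n v))"
proof (induction n)
  case 0
  show ?case by (simp add: run_transform_def word_of_def)
next
  case (Suc n)
  have "section_at A s (word_of k n v) < m"
    using section_at_closed[OF fin, of s "word_of k n v"] assms word_of_in_words
    by (simp add: states words_of_length_def)
  moreover have "v div k ^ n mod k < k"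
    using fin by (auto simp: finite_automaton_def letters)
  ultimately show ?case
    using Suc by (simp add: run_transform_def run_section_eq[OF assms] word_of_Suc transform_snoc
        num_of_snoc code_nth_table_code)
qed

lemma colouring_test_correct:
  "colouring_test k m (table_code k m A) n \<longleftrightarrow> transitive_on_level A n"
proof
  have num: "num_of k w < k ^ n" "word_of k n (num_of k w) = w" if "w \<in> words_of_length A n" for w
    using that num_of_less[of w k] word_of_num_of[of w k]
    by (auto simp: words_of_length_def words_def letters lists_eq_set)
  {
    assume test: "colouring_test k m (table_code k m A) n"
    show "transitive_on_level A n"
      unfolding transitive_on_level_def
    proof (intro allI impI)
      fix f :: "nat list \<Rightarrow> bool"
      assume f: "\<forall>s\<in>states A. \<forall>v\<in>words_of_length A n. f (transform A s v) = f v"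
      define B where "B = {v. v < k ^ n \<and> f (word_of k n v)}"
      \<comment> \<open>\<open>set_encode\<close> sets bit \<open>v\<close> exactly for
        \<open>v\<close> in \<open>B\<close>, so the digits of \<open>M\<close> are the
        colouring.\<close>
      define M where "M = set_encode B"
      have B: "finite B" by (simp add: B_def)
      have "M \<le> (\<Sum>i<k ^ n. 2 ^ i)"
        unfolding M_def set_encode_def by (intro sum_mono2) (auto simp: B_def)
      also have "\<dots> < 2 ^ (k ^ n)"
        by (simp add: sum_power2 lessThan_atLeast0 del: atLeastLessThan_iff)
      finally have M: "M < 2 ^ (k ^ n)" .
      have "set_decode M = B" using B by (simp add: M_def)
      then have odd: "odd (M div 2 ^ v) \<longleftrightarrow> v \<in> B" for v
        by (auto simp: set_decode_def)
      have bit: "M div 2 ^ v mod 2 = of_bool (v \<in> B)" for v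
        using odd[of v] by (auto simp: mod2_eq_if)
      have "\<forall>v<k ^ n. \<forall>s<m. M div 2 ^ run_transform k (table_code k m A) s v n mod 2 = M div 2 ^ v mod 2"
      proof (intro allI impI)
        fix v s assume vs: "v < k ^ n" "s < m"
        let ?w = "transform A s (word_of k n v)"
        have w: "?w \<in> words_of_length A n"
          using transform_closed[OF fin _ word_of_in_words] vs by (simp add: states)
        have "f ?w = f (word_of k n v)"
          using f vs word_of_in_words by (simp add: states)
        then have "num_of k ?w \<in> B \<longleftrightarrow> v \<in> B"
          using num[OF w] vs by (simp add: B_def)
        then show "M div 2 ^ run_transform k (table_code k m A) s v n mod 2 = M div 2 ^ v mod 2"
          by (simp add: run_transform_eq vs bit)
      qed
      then have "\<forall>v<k ^ n. M div 2 ^ v mod 2 = M mod 2"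
        using test M unfolding colouring_test_def by blast
      then have "M div 2 ^ v mod 2 = M div 2 ^ 0 mod 2" if "v < k ^ n" for v
        using that by simp
      then have const: "v \<in> B \<longleftrightarrow> 0 \<in> B" if "v < k ^ n" for v
        using that unfolding bit of_bool_eq_iff .
      have "f w \<longleftrightarrow> 0 \<in> B" if "w \<in> words_of_length A n" for w
        using const[OF num(1)[OF that]] num[OF that] by (simp add: B_def)
      then show "(\<forall>v\<in>words_of_length A n. f v) \<or> (\<forall>v\<in>words_of_length A n. \<not> f v)" by blast
    qed
  }
  {
    assume tr: "transitive_on_level A n"
    show "colouring_test k m (table_code k m A) n"
      unfolding colouring_test_def
    proof (intro allI impI)
      fix M v :: nat
      assume inv: "\<forall>v<k ^ n. \<forall>s<m.
          M div 2 ^ run_transform k (table_code k m A) s v n mod 2 = M div 2 ^ v mod 2"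
        and v: "v < k ^ n"
      define f where "f w \<longleftrightarrow> M div 2 ^ num_of k w mod 2 = 0" for w
      have "f (transform A s w) = f w" if "s \<in> states A" "w \<in> words_of_length A n" for s w
        using inv[rule_format, OF num(1)[OF that(2)], of s] that
        by (simp add: run_transform_eq num states f_def)
      then have "(\<forall>v\<in>words_of_length A n. f v) \<or> (\<forall>v\<in>words_of_length A n. \<not> f v)"
        using tr unfolding transitive_on_level_def by blast
      \<comment> \<open>The word with number 0 is the reference, because \<open>M mod 2\<close> is
        the digit at place 0.\<close>
      then have "f (word_of k n v) = f (word_of k n 0)"
        using word_of_in_words by blast
      then show "M div 2 ^ v mod 2 = M mod 2"
        using v by (simp add: f_def num_of_word_of) (metis not_mod_2_eq_0_eq_1)
    qed
  }
qed

end

lemma computable_colouring_test: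
  assumes "computable n a" "computable n b" "computable n c" "computable n d"
  shows "computable n (\<lambda>xs. of_bool (colouring_test (a xs) (b xs) (c xs) (d xs)))"
proof -
  \<comment> \<open>Each nested quantifier is hidden behind a predicate with explicit parameters, so
    that below a new quantifier these are again entries within reach of the projection
    rules.\<close>
  define keeps where "keeps M v k z n m \<longleftrightarrow>
    (\<forall>s<m. M div 2 ^ run_transform k z s v n mod 2 = M div 2 ^ v mod 2)" for M v k z n m :: nat
  have keeps: "computable n (\<lambda>xs. of_bool (keeps (a xs) (b xs) (c xs) (d xs) (e xs) (f xs)))"
    if "computable n a" "computable n b" "computable n c" "computable n d" "computable n e"
      "computable n f" for n a b c d e f
    by (rule computable_compose6[OF _ that, of "\<lambda>a b c d e f. of_bool (keeps a b c d e f)"],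
        unfold keeps_def, intro computable_all_less computable_arith computable_run_transform) auto
  define good where "good M k m z n \<longleftrightarrow> (\<forall>v<k ^ n. keeps M v k z n m) \<longrightarrow>
    (\<forall>v<k ^ n. M div 2 ^ v mod 2 = M mod 2)" for M k m z n :: nat
  have good: "computable n (\<lambda>xs. of_bool (good (a xs) (b xs) (c xs) (d xs) (e xs)))"
    if "computable n a" "computable n b" "computable n c" "computable n d" "computable n e"
    for n a b c d e
    by (rule computable_compose5[OF _ that, of "\<lambda>a b c d e. of_bool (good a b c d e)"],
        unfold good_def, intro computable_imp computable_all_less computable_arith keeps) auto
  define test where "test k m z n \<longleftrightarrow> (\<forall>M<2 ^ (k ^ n). good M k m z n)" for k m z n :: nat
  have "computable n (\<lambda>xs. of_bool (test (a xs) (b xs) (c xs) (d xs)))"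
    by (rule computable_compose4[OF _ assms, of "\<lambda>a b c d. of_bool (test a b c d)"],
        unfold test_def, intro computable_all_less computable_arith good) auto
  then show ?thesis
    by (simp add: test_def good_def keeps_def colouring_test_def)
qed

subsection \<open>Level-transitivity and invariant colourings\<close>

lemma state_map_Bij:
  assumes "invertible A" "s \<in> states A"
  shows "state_map A s \<in> carrier (BijGroup (words A))"
  using assms by (auto simp: invertible_def BijGroup_def Bij_def state_map_def)

lemma transform_in_words:
  "finite_automaton A \<Longrightarrow> s \<in> states A \<Longrightarrow> v \<in> words A \<Longrightarrow> transform A s v \<in> words A"
  using transform_closed[of A s v "length v"] by (auto simp: words_of_length_def)

lemma automaton_group_carrier:
  assumes "invertible A"
  shows "carrier (automaton_group A) = generate (BijGroup (words A)) (state_map A ` states A)"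
proof -
  have "carrier (BijGroup (words A)) \<inter> state_map A ` states A = state_map A ` states A"
    using state_map_Bij[OF assms] by blast
  then show ?thesis by (simp add: automaton_group_def carrier_subgroup_generated)
qed

lemma automaton_group_Bij:
  assumes "invertible A" "g \<in> carrier (automaton_group A)"
  shows "g \<in> Bij (words A)"
proof -
  interpret group "BijGroup (words A)" by (rule group_BijGroup)
  have "g \<in> carrier (BijGroup (words A))"
    using assms generate_in_carrier[of "state_map A ` states A"] state_map_Bij[OF assms(1)]
    by (auto simp: automaton_group_carrier)
  then show ?thesis by (simp add: BijGroup_def)
qed

lemma automaton_group_mult:
  assumes "invertible A" "g \<in> carrier (automaton_group A)" "h \<in> carrier (automaton_group A)"
  shows "compose (words A) g h \<in> carrier (automaton_group A)"
proof -
  have "g \<otimes>\<^bsub>BijGroup (words A)\<^esub> h \<in> carrier (automaton_group A)"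
    using assms unfolding automaton_group_carrier[OF assms(1)] by (intro generate.eng)
  moreover have "g \<otimes>\<^bsub>BijGroup (words A)\<^esub> h = compose (words A) g h"
    using automaton_group_Bij[OF assms(1)] assms(2,3) by (simp add: BijGroup_def)
  ultimately show ?thesis by simp
qed

lemma automaton_group_one:
  assumes "invertible A"
  shows "restrict (\<lambda>v. v) (words A) \<in> carrier (automaton_group A)"
  using generate.one[of "BijGroup (words A)"] assms
  by (simp add: automaton_group_carrier BijGroup_def)

text \<open>Induction over the generated group: products compose, and for an inverse
  \<open>v\<close> is the image of a word \<open>u\<close> of the same length, where invariance
  gives \<open>f v = f u\<close>.\<close>

lemma automaton_group_invariant:
  assumes fin: "finite_automaton A" and inv: "invertible A"
    and f: "\<And>s v. s \<in> states A \<Longrightarrow> v \<in> words_of_length A n \<Longrightarrow> f (transform A s v) = f v"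
    and g: "g \<in> carrier (automaton_group A)" and v: "v \<in> words_of_length A n"
  shows "g v \<in> words_of_length A n \<and> f (g v) = f v"
proof -
  have "g \<in> generate (BijGroup (words A)) (state_map A ` states A)"
    using g by (simp add: automaton_group_carrier[OF inv])
  then show ?thesis
    using v
  proof (induction arbitrary: v)
    case one
    then show ?case by (auto simp: BijGroup_def words_of_length_def)
  next
    case (incl h)
    then show ?case using f transform_closed[OF fin]
      by (auto simp: state_map_def words_of_length_def)
  next
    case (inv h)
    then obtain s where s: "s \<in> states A" "h = state_map A s" by blast
    have bij: "bij_betw h (words A) (words A)"
      using assms(2) s by (auto simp: invertible_def)
    have hB: "h \<in> Bij (words A)"
      using state_map_Bij[OF assms(2) s(1)] s(2) by (simp add: BijGroup_def)
    define u where "u = inv_into (words A) h v"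
    have v: "v \<in> words A" "length v = n" using inv.prems by (auto simp: words_of_length_def)
    have u: "u \<in> words A" "h u = v"
      using v bij by (auto simp: u_def bij_betw_def inv_into_into f_inv_into_f)
    have "transform A s u = v" using u s by (simp add: state_map_def)
    moreover from this have "u \<in> words_of_length A n"
      using u v length_transform[of A s u] by (simp add: words_of_length_def)
    ultimately have "f v = f u" using f s by blast
    moreover have "(inv\<^bsub>BijGroup (words A)\<^esub> h) v = u"
      using v by (simp add: inv_BijGroup[OF hB] u_def)
    ultimately show ?case using \<open>u \<in> words_of_length A n\<close> by simp
  next
    case (eng h1 h2)
    interpret group "BijGroup (words A)" by (rule group_BijGroup)
    have "h1 \<in> Bij (words A)" "h2 \<in> Bij (words A)"
      using eng.hyps automaton_group_Bij[OF assms(2)] by (simp_all add: automaton_group_carrier[OF assms(2)])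
    then have "(h1 \<otimes>\<^bsub>BijGroup (words A)\<^esub> h2) v = h1 (h2 v)"
      using eng.prems by (simp add: BijGroup_def compose_def words_of_length_def)
    then show ?case using eng.IH eng.prems by simp
  qed
qed

lemma card_eq_1_iff_all_eq:
  "card S = 1 \<longleftrightarrow> S \<noteq> {} \<and> (\<forall>x\<in>S. \<forall>y\<in>S. x = y)"
  unfolding is_singleton_altdef[symmetric] by (auto elim: is_singletonE intro!: is_singletonI')

text \<open>An invariant colouring is constant along orbits. Conversely, membership in one orbit is
  an invariant colouring; if it is constant, the orbit is the whole level.\<close>

lemma level_transitive_iff:
  assumes fin: "finite_automaton A" and inv: "invertible A"
  shows "level_transitive A \<longleftrightarrow> (\<forall>n. transitive_on_level A n)"
proof -
  let ?G = "automaton_group A"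
  have "card (orbits ?G (words_of_length A n) (\<lambda>g. restrict g (words_of_length A n))) = 1
      \<longleftrightarrow> transitive_on_level A n" for n
  proof -
    let ?W = "words_of_length A n"
    define orb where "orb v = {g v | g. g \<in> carrier ?G}" for v
    have "orbit ?G (\<lambda>g. restrict g ?W) v = orb v" if "v \<in> ?W" for v
      using that by (auto simp: orbit_def orb_def)
    then have orbits: "orbits ?G ?W (\<lambda>g. restrict g ?W) = orb ` ?W"
      by (auto simp: orbits_def)
    \<comment> \<open>The number of orbits has to be 1 and not 0.\<close>
    have W: "?W \<noteq> {}"
    proof -
      have "card ?W \<noteq> 0"
        using fin by (subst card_words_of_length) (auto simp: finite_automaton_def)
      then show ?thesis by auto
    qed
    have self: "v \<in> orb v" if "v \<in> ?W" for v
    proof -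
      have "v = restrict (\<lambda>v. v) (words A) v" using that by (simp add: words_of_length_def)
      then show ?thesis using automaton_group_one[OF inv] unfolding orb_def by blast
    qed
    have sub: "w \<in> ?W" if "w \<in> orb v" "v \<in> ?W" for v w
      using automaton_group_invariant[OF fin inv, of n "\<lambda>_. True"] that by (auto simp: orb_def)
    have "(\<forall>v\<in>?W. \<forall>w\<in>?W. orb v = orb w) \<longleftrightarrow> transitive_on_level A n"
    proof
      assume eq: "\<forall>v\<in>?W. \<forall>w\<in>?W. orb v = orb w"
      show "transitive_on_level A n"
        unfolding transitive_on_level_def
      proof (intro allI impI)
        fix f :: "'b list \<Rightarrow> bool"
        assume f: "\<forall>s\<in>states A. \<forall>v\<in>?W. f (transform A s v) = f v"
        have "f w = f v" if "v \<in> ?W" "w \<in> ?W" for v w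
        proof -
          have "w \<in> orb v" using eq self that by blast
          then obtain g where g: "g \<in> carrier ?G" "w = g v" by (auto simp: orb_def)
          have "f (g v) = f v"
            by (rule automaton_group_invariant[OF fin inv _ g(1) that(1), THEN conjunct2])
              (use f in blast)
          then show ?thesis using g(2) by simp
        qed
        then show "(\<forall>v\<in>?W. f v) \<or> (\<forall>v\<in>?W. \<not> f v)" by blast
      qed
    next
      assume tr: "transitive_on_level A n"
      have "orb v = ?W" if v: "v \<in> ?W" for v
      proof -
        have "(transform A s w \<in> orb v) = (w \<in> orb v)" if s: "s \<in> states A" and w: "w \<in> ?W" for s w
        proof -
          let ?h = "state_map A s"
          have vw: "v \<in> words A" "w \<in> words A" using v w by (auto simp: words_of_length_def)
          have h: "?h \<in> carrier ?G"
            using s by (auto simp: automaton_group_carrier[OF inv] intro: generate.incl)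
          have hinv: "inv\<^bsub>BijGroup (words A)\<^esub> ?h \<in> carrier ?G"
            using s by (auto simp: automaton_group_carrier[OF inv] intro: generate.inv)
          have hB: "?h \<in> Bij (words A)" using automaton_group_Bij[OF inv h] .
          show ?thesis
          proof
            \<comment> \<open>Here group inverses enter: \<open>w\<close> is recovered from its
              image by the inverse of \<open>?h\<close>.\<close>
            assume "transform A s w \<in> orb v"
            then obtain g where g: "g \<in> carrier ?G" "transform A s w = g v" by (auto simp: orb_def)
            have hw: "?h w = g v" using g(2) vw by (simp add: state_map_def)
            moreover have "g v \<in> words A"
              using g(2) transform_in_words[OF fin s vw(2)] by simp
            ultimately have "compose (words A) (inv\<^bsub>BijGroup (words A)\<^esub> ?h) g v =
                inv_into (words A) ?h (?h w)"
              unfolding inv_BijGroup[OF hB] using vw(1) by (simp add: compose_def)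
            also have "\<dots> = w"
              using hB vw(2) by (intro inv_into_f_f) (simp_all add: Bij_def bij_betw_def)
            finally have "w = compose (words A) (inv\<^bsub>BijGroup (words A)\<^esub> ?h) g v" ..
            then show "w \<in> orb v"
              using automaton_group_mult[OF inv hinv g(1)] unfolding orb_def by blast
          next
            assume "w \<in> orb v"
            then obtain g where g: "g \<in> carrier ?G" "w = g v" by (auto simp: orb_def)
            then have "transform A s w = compose (words A) ?h g v"
              using vw by (simp add: compose_def state_map_def)
            then show "transform A s w \<in> orb v"
              using automaton_group_mult[OF inv h g(1)] unfolding orb_def by blast
          qed
        qed
        then have "\<forall>s\<in>states A. \<forall>w\<in>?W. (transform A s w \<in> orb v) = (w \<in> orb v)"
          by blast
        with tr have "(\<forall>w\<in>?W. w \<in> orb v) \<or> (\<forall>w\<in>?W. w \<notin> orb v)"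
          unfolding transitive_on_level_def by (elim allE[of _ "\<lambda>w. w \<in> orb v"] impE)
        then show ?thesis using self[OF v] sub[OF _ v] v by blast
      qed
      then show "\<forall>v\<in>?W. \<forall>w\<in>?W. orb v = orb w" by blast
    qed
    then show ?thesis unfolding card_eq_1_iff_all_eq orbits using W by auto
  qed
  then show ?thesis unfolding level_transitive_def by blast
qed

subsection \<open>Words with nontrivial section\<close>

lemma transform_trivial_state:
  "trivial_state A s \<Longrightarrow> v \<in> words A \<Longrightarrow> transform A s v = v"
  by (simp add: trivial_state_def state_map_def)

text \<open>\<open>s\<close> fixes both \<open>v @ w\<close> and \<open>v\<close>, so its section
  fixes \<open>w\<close>. Contrapositively, nontriviality of a section passes to prefixes.\<close>

lemma trivial_state_section_at:
  assumes "trivial_state A s" "v \<in> words A"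
  shows "trivial_state A (section_at A s v)"
proof -
  have "transform A (section_at A s v) w = w" if "w \<in> words A" for w
  proof -
    have "v @ w \<in> words A" using assms(2) that by (simp add: words_def)
    then have "transform A s (v @ w) = v @ w" "transform A s v = v"
      using assms by (simp_all add: transform_trivial_state)
    then show ?thesis by (simp add: transform_append)
  qed
  then show ?thesis by (simp add: trivial_state_def state_map_def)
qed

lemma transform_snoc_trivial:
  assumes "trivial_state A (section_at A s v)" "x \<in> letters A"
  shows "transform A s (v @ [x]) = transform A s v @ [x]"
proof -
  have "transform A (section_at A s v) [x] = [x]"
    by (rule transform_trivial_state[OF assms(1)]) (use assms(2) in \<open>simp add: words_def\<close>)
  then show ?thesis by (simp only: transform_append)
qed

definition active_words :: "('s, 'x) automaton \<Rightarrow> nat \<Rightarrow> 's \<Rightarrow> 'x list set" where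
  "active_words A n s = {v \<in> words_of_length A n. \<not> trivial_state A (section_at A s v)}"

section \<open>Powers of a word and periodicity\<close>

lemma length_power_list [simp]: "length (concat (replicate r c)) = r * length c"
  by (induction r) auto

lemma set_power_list: "set (concat (replicate r c)) \<subseteq> set c"
  by (induction r) auto

lemma nth_power_list: "p < r * length c \<Longrightarrow> concat (replicate r c) ! p = c ! (p mod length c)"
  by (induction r arbitrary: p) (auto simp: nth_append le_mod_geq[symmetric])

text \<open>The equation lays \<open>g\<close> over its own shift by \<open>r * length c\<close>:
  letters before that offset are read off the copies of \<open>c\<close>, and every later letter
  equals the one \<open>r * length c\<close> places earlier.\<close>

lemma periodic_if_prefix_of_shift:
  assumes r: "r > 0" "c \<noteq> []" and eq: "g @ u = concat (replicate r c) @ g @ w"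
    and p: "p < length g"
  shows "g ! p = c ! (p mod length c)"
  using p
proof (induction p rule: less_induct)
  case (less p)
  have g: "g ! p = (concat (replicate r c) @ g @ w) ! p"
    using less.prems by (simp add: eq[symmetric] nth_append)
  show ?case
  proof (cases "p < r * length c")
    case True
    then show ?thesis using g by (simp add: nth_append nth_power_list)
  next
    case False
    then have "g ! p = g ! (p - r * length c)"
      using g less.prems by (simp add: nth_append less_imp_diff_less)
    also have "\<dots> = c ! ((p - r * length c) mod length c)"
    proof (rule less.IH)
      have "0 < r * length c" using r by simp
      then show "p - r * length c < p" using False by linarith
      show "p - r * length c < length g" using less.prems by simp
    qed
    also have "(p - r * length c) mod length c = p mod length c"
      using False by (metis le_add_diff_inverse2 linorder_not_less mod_mult_self1 mult.commute)
    finally show ?thesis .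
  qed
qed

lemma section_at_power:
  "section_at A s c = s \<Longrightarrow> section_at A s (concat (replicate r c)) = s"
  by (induction r) (auto simp: section_at_append)

text \<open>
  If \<open>g\<close> left the cycle \<open>c\<close> before reaching another cycle \<open>d\<close>, the words
  \<open>c\<^sup>i g d\<^sup>j\<close> with suitable constant total length would be linearly many.
\<close>

lemma path_between_cycles_periodic:
  assumes C: "\<And>n. card (active_words A n s) \<le> C" and fin: "finite (letters A)"
    and words: "c \<in> words A" "g \<in> words A" "d \<in> words A"
    and c: "c \<noteq> []" "section_at A s c = s"
    and d: "d \<noteq> []" "section_at A (section_at A s g) d = section_at A s g"
    and active: "\<not> trivial_state A (section_at A s g)"
    and p: "p < length g"
  shows "g ! p = c ! (p mod length c)"
proof -
  let ?a = "length c" and ?b = "length d"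
  define P where "P i = concat (replicate (?b * i) c) @ g @ concat (replicate (?a * (C - i)) d)" for i
  have pw: "concat (replicate r u) \<in> words A" if "u \<in> words A" for r u
    using set_power_list[of r u] that by (auto simp: words_def lists_eq_set)
  have P: "P i \<in> active_words A (?a * ?b * C + length g) s" if "i \<le> C" for i
  proof -
    have "?b * i * ?a + ?a * (C - i) * ?b = ?a * ?b * (i + (C - i))"
      by (simp only: algebra_simps)
    then have "length (P i) = ?a * ?b * C + length g" using that by (simp add: P_def)
    moreover have "P i \<in> words A" using pw words by (simp add: P_def words_def)
    moreover have "section_at A s (P i) = section_at A s g"
      by (simp add: P_def section_at_append section_at_power c d)
    ultimately show ?thesis using active by (simp add: active_words_def words_of_length_def)
  qed
  \<comment> \<open>The \<open>C + 1\<close> words \<open>P i\<close> all lie in a set of at most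
    \<open>C\<close> words.\<close>
  have "\<not> inj_on P {..C}"
  proof
    assume "inj_on P {..C}"
    then have "Suc C = card (P ` {..C})" by (simp add: card_image)
    also have "\<dots> \<le> card (active_words A (?a * ?b * C + length g) s)"
      using P finite_words_of_length[OF fin] by (intro card_mono) (auto simp: active_words_def)
    also have "\<dots> \<le> C" by (rule C)
    finally show False by simp
  qed
  then obtain i j where ij: "i < j" "P i = P j"
    by (metis (full_types) inj_onI linorder_neqE_nat)
  define u where "u l = concat (replicate (?a * (C - l)) d)" for l
  \<comment> \<open>Cancelling the first \<open>?b * i\<close> copies of \<open>c\<close> in
    \<open>P i = P j\<close> leaves an overlap of \<open>g\<close> with its own shift.\<close>
  have "replicate (?b * j) c = replicate (?b * i) c @ replicate (?b * (j - i)) c"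
    using ij(1) by (simp add: replicate_add[symmetric] distrib_left[symmetric])
  then have "g @ u i = concat (replicate (?b * (j - i)) c) @ g @ u j"
    using ij(2) by (simp add: P_def u_def)
  then show ?thesis
    using periodic_if_prefix_of_shift[of "?b * (j - i)" c g "u i" "u j" p] ij(1) c d p by simp
qed

text \<open>Pigeonhole on the prefixes of lengths 0 to \<open>card (states A)\<close>; the letters
  between positions \<open>i\<close> and \<open>j\<close> label a cycle.\<close>

lemma repeated_section:
  assumes fin: "finite_automaton A" and s: "s \<in> states A" and v: "v \<in> words A"
    and len: "card (states A) \<le> length v"
  obtains i j where "i < j" "j \<le> card (states A)"
    "section_at A s (take i v) = section_at A s (take j v)"
proof -
  let ?f = "\<lambda>i. section_at A s (take i v)"
  have "take i v \<in> words A" for i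
    using v by (auto simp: words_def lists_eq_set dest: in_set_takeD)
  then have "?f ` {..card (states A)} \<subseteq> states A"
    using section_at_closed[OF fin s] by blast
  then have "card (?f ` {..card (states A)}) \<le> card (states A)"
    using fin by (intro card_mono) (auto simp: finite_automaton_def)
  then have "card (?f ` {..card (states A)}) < card {..card (states A)}" by simp
  then have "\<not> inj_on ?f {..card (states A)}" by (rule pigeonhole)
  then obtain i j where "i < j" "j \<le> card (states A)" "?f i = ?f j"
    by (metis (no_types, lifting) atMost_iff inj_onI linorder_neqE_nat)
  then show thesis by (rule that)
qed

text \<open>For \<open>m < n\<close> the run has a cycle within the first \<open>m\<close> letters
  and one within the last \<open>m\<close>. By \<open>path_between_cycles_periodic\<close> the word
  keeps repeating the first cycle up to the second, so its middle is determined by the first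
  \<open>m\<close> letters.\<close>

lemma active_words_inj:
  assumes fin: "finite_automaton A" and s: "s \<in> states A"
    and C: "\<And>n s. s \<in> states A \<Longrightarrow> card (active_words A n s) \<le> C"
  defines "m \<equiv> card (states A)"
  shows "inj_on (\<lambda>v. (take m v, drop (n - m) v)) (active_words A n s)"
proof (cases "n \<le> m")
  case True
  then show ?thesis by (auto intro!: inj_onI)
next
  case False
  then have mn: "m < n" by simp
  have per: "v ! (i + p) = drop i (take j v) ! (p mod (j - i))"
    if v: "v \<in> active_words A n s" and i: "i < j" "j \<le> m"
      and cyc: "section_at A s (take i v) = section_at A s (take j v)"
      and p: "i + p < n - m" for v i j p
  proof -
    have vw: "v \<in> words A" "length v = n" "\<not> trivial_state A (section_at A s v)"
      using v by (auto simp: active_words_def words_of_length_def)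
    have sub: "w \<in> words A" if "set w \<subseteq> set v" for w
      using that vw by (auto simp: words_def lists_eq_set)
    define s1 where "s1 = section_at A s (take i v)"
    define c where "c = drop i (take j v)"
    have c: "length c = j - i" using i mn vw by (simp add: c_def)
    have ic: "take i v @ c = take j v"
      unfolding c_def using i by (metis append_take_drop_id min.absorb1 order_less_imp_le take_take)
    have s1c: "section_at A s1 c = s1"
      using cyc by (metis ic s1_def section_at_append)
    \<comment> \<open>\<open>s2\<close> is reached before the last \<open>m\<close> letters; its run
      through them repeats a state and so yields the second cycle \<open>d\<close>.\<close>
    define s2 where "s2 = section_at A s (take (n - m) v)"
    have "take (n - m) v \<in> words A" "drop (n - m) v \<in> words A" "take i v \<in> words A"
      by (auto intro!: sub dest: in_set_takeD in_set_dropD)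
    then have s2: "s2 \<in> states A" and s1: "s1 \<in> states A"
      unfolding s1_def s2_def using section_at_closed[OF fin s] by auto
    obtain i' j' where ij': "i' < j'" "j' \<le> m"
      "section_at A s2 (take i' (drop (n - m) v)) = section_at A s2 (take j' (drop (n - m) v))"
      using repeated_section[OF fin s2 \<open>drop (n - m) v \<in> words A\<close>] vw mn by (auto simp: m_def)
    \<comment> \<open>\<open>g\<close> leads from the start of the first cycle to the start of the
      second, so it covers all positions from \<open>i\<close> up to \<open>n - m\<close>.\<close>
    define g where "g = drop i (take (n - m + i') v)"
    define d where "d = drop i' (take j' (drop (n - m) v))"
    have ig: "take i v @ g = take (n - m + i') v"
      unfolding g_def using p by (metis append_take_drop_id le_add1 min.absorb1 order_trans
          add_leD1 less_imp_le take_take)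
    have tg: "section_at A s1 g = section_at A s2 (take i' (drop (n - m) v))"
      unfolding s1_def s2_def section_at_append[symmetric] ig by (simp add: take_add)
    have tgd: "section_at A (section_at A s1 g) d = section_at A s1 g"
    proof -
      have "take i' (drop (n - m) v) @ d = take j' (drop (n - m) v)"
        unfolding d_def using ij'
        by (metis append_take_drop_id min.absorb1 order_less_imp_le take_take)
      then show ?thesis unfolding tg ij'(3) by (metis ij'(3) section_at_append)
    qed
    have "section_at A s v = section_at A (section_at A s1 g) (drop (n - m + i') v)"
      unfolding s1_def section_at_append[symmetric] using ig by (simp flip: append_assoc)
    moreover have "drop (n - m + i') v \<in> words A"
      by (auto intro!: sub dest: in_set_dropD)
    ultimately have active: "\<not> trivial_state A (section_at A s1 g)"
      using vw(3) trivial_state_section_at by metis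
    have "p < length g" using p vw mn ij' by (simp add: g_def)
    moreover have "c \<noteq> []" using c i by auto
    moreover have "d \<noteq> []" using ij' vw mn by (auto simp: d_def)
    moreover have "c \<in> words A" "g \<in> words A" "d \<in> words A"
      unfolding c_def g_def d_def by (auto intro!: sub dest!: in_set_takeD in_set_dropD)
    ultimately have "g ! p = c ! (p mod length c)"
      using path_between_cycles_periodic[of A s1 C c g d p] C[OF s1] fin s1c tgd active
      by (simp add: finite_automaton_def)
    moreover have "g ! p = v ! (i + p)"
      using p vw mn ij' by (simp add: g_def)
    ultimately have "v ! (i + p) = c ! (p mod length c)" by metis
    then show ?thesis unfolding c unfolding c_def .
  qed
  show ?thesis
  proof (rule inj_onI)
    fix v w assume v: "v \<in> active_words A n s" and w: "w \<in> active_words A n s"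
      and eq: "(take m v, drop (n - m) v) = (take m w, drop (n - m) w)"
    have len: "length v = n" "length w = n" "v \<in> words A"
      using v w by (auto simp: active_words_def words_of_length_def)
    have "card (states A) \<le> length v" using len mn by (simp add: m_def)
    from repeated_section[OF fin s len(3) this] obtain i j where ij: "i < j" "j \<le> m"
      "section_at A s (take i v) = section_at A s (take j v)"
      unfolding m_def by blast
    have tk: "take l v = take l w" if "l \<le> m" for l
      using eq that by (metis Pair_inject min.absorb1 take_take)
    show "v = w"
    proof (rule nth_equalityI)
      fix q assume q: "q < length v"
      consider "q < m" | "m \<le> q" "q < n - m" | "n - m \<le> q" by linarith
      then show "v ! q = w ! q"
      proof cases
        case 1
        then show ?thesis using eq by (metis Pair_inject nth_take)
      next
        case 2
        then have "i + (q - i) = q" using ij by simp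
        \<comment> \<open>\<open>w\<close> shares the first \<open>m\<close> letters of
          \<open>v\<close>, hence has the same cycle at the same positions.\<close>
        moreover have "section_at A s (take i w) = section_at A s (take j w)"
          using ij tk[of i] tk[of j] by simp
        ultimately show ?thesis
          using per[OF v ij, of "q - i"] per[OF w ij(1,2), of "q - i"] 2 tk[OF ij(2)] by simp
      next
        case 3
        have "drop (n - m) v ! (q - (n - m)) = drop (n - m) w ! (q - (n - m))"
          using eq by simp
        then show ?thesis using 3 q len by simp
      qed
    qed (simp add: len)
  qed
qed

text \<open>The constant in the definition of boundedness is merely known to exist; the injection
  into pairs of end pieces replaces it by a bound computable from the sizes of alphabet and state
  set.\<close>

lemma card_active_words:
  assumes bd: "bounded_automaton A" and s: "s \<in> states A"
  shows "card (active_words A n s) \<le> card (letters A) ^ (2 * card (states A))"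
proof -
  have fin: "finite_automaton A" using bd by (simp add: bounded_automaton_def)
  then have fl: "finite (letters A)" and k: "card (letters A) \<ge> 1"
    by (auto simp: finite_automaton_def)
  obtain C where C: "\<And>n s. s \<in> states A \<Longrightarrow> card (active_words A n s) \<le> C"
    using bd unfolding bounded_automaton_def active_words_def by blast
  let ?m = "card (states A)"
  \<comment> \<open>For \<open>n\<close> below \<open>?m\<close> both end pieces are the whole
    word.\<close>
  let ?W = "words_of_length A (min ?m n)"
  let ?f = "\<lambda>v. (take ?m v, drop (n - ?m) v)"
  have "?f ` active_words A n s \<subseteq> ?W \<times> ?W"
    by (auto simp: active_words_def words_of_length_def words_def dest: in_set_takeD in_set_dropD)
  then have "card (active_words A n s) \<le> card (?W \<times> ?W)"
    by (intro card_inj_on_le[OF active_words_inj[OF fin s C]]) (auto simp: finite_words_of_length fl)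
  also have "\<dots> = card (letters A) ^ (2 * min ?m n)"
    by (simp add: card_cartesian_product card_words_of_length fl power_add[symmetric] mult_2)
  also have "\<dots> \<le> card (letters A) ^ (2 * ?m)"
    using k by (intro power_increasing) auto
  finally show ?thesis .
qed

subsection \<open>Recurrence of the levels\<close>

lemma map_filter_cong_list_all2:
  assumes "list_all2 S xs ys"
    and "\<And>x y. S x y \<Longrightarrow> Q x = Q' y" "\<And>x y. S x y \<Longrightarrow> F x = F' y"
  shows "map F (filter Q xs) = map F' (filter Q' ys)"
  using assms(1) by (induction rule: list_all2_induct) (use assms(2,3) in auto)

text \<open>An invariant colouring of level \<open>n\<close> lifts to the next level by ignoring the
  last letter, since the first \<open>n\<close> output letters depend on the first \<open>n\<close>
  input letters only.\<close>

lemma transitive_on_level_Suc: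
  fixes A :: "('s, 'x) automaton"
  assumes "letters A \<noteq> {}" "transitive_on_level A (Suc n)"
  shows "transitive_on_level A n"
  unfolding transitive_on_level_def
proof (intro allI impI)
  fix f :: "'x list \<Rightarrow> bool"
  assume f: "\<forall>s\<in>states A. \<forall>v\<in>words_of_length A n. f (transform A s v) = f v"
  have "f (butlast (transform A s w)) = f (butlast w)"
    if "s \<in> states A" "w \<in> words_of_length A (Suc n)" for s w
    using that(2) by (rule words_of_length_SucE) (use f that(1) in \<open>simp add: transform_snoc\<close>)
  then have "(\<forall>w\<in>words_of_length A (Suc n). f (butlast w)) \<or>
      (\<forall>w\<in>words_of_length A (Suc n). \<not> f (butlast w))"
    using assms(2)[unfolded transitive_on_level_def, rule_format, of "\<lambda>w. f (butlast w)"] by blast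
  moreover obtain x where "x \<in> letters A" using assms(1) by blast
  then have "v @ [x] \<in> words_of_length A (Suc n)" if "v \<in> words_of_length A n" for v
    using that by (simp add: words_of_length_Suc_iff)
  ultimately show "(\<forall>v\<in>words_of_length A n. f v) \<or> (\<forall>v\<in>words_of_length A n. \<not> f v)"
    by (metis butlast_snoc)
qed

lemma transitive_on_level_le:
  assumes "letters A \<noteq> {}" "transitive_on_level A n" "i \<le> n"
  shows "transitive_on_level A i"
  using assms(3,2) by (induction rule: dec_induct) (auto intro: transitive_on_level_Suc[OF assms(1)])

lemma sum_power_le: "(\<Sum>i\<le>n. b ^ i) \<le> Suc b ^ n" for b :: nat
proof (induction n)
  case (Suc n)
  have "b ^ n \<le> Suc b ^ n" by (rule power_mono) auto
  then have "b ^ Suc n \<le> b * Suc b ^ n" by simp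
  with Suc show ?case
    by (simp only: sum.atMost_Suc power_Suc mult_Suc)
qed simp

text \<open>
  A level has at most \<open>m * k\<^sup>2\<^sup>m\<close> ports, each with at most \<open>4 * m\<close> labels in a
  \<open>port_pattern\<close>; the exponent bounds the number of possible elements of a \<open>level_code\<close>.
\<close>

definition level_bound :: "nat \<Rightarrow> nat \<Rightarrow> nat" where
  "level_bound k m = 2 ^ (4 * Suc (4 * m) ^ (m * k ^ (2 * m)))"

context
  fixes A :: "(nat, nat) automaton" and k m :: nat
  assumes bd: "bounded_automaton A" and letters: "letters A = {..<k}" and states: "states A = {..<m}"
begin

private lemma fin: "finite_automaton A"
  using bd by (simp add: bounded_automaton_def)

text \<open>
  A list rather than a set: its order gives every port of level \<open>n + 1\<close> a position that is
  determined by the sections at the ports of level \<open>n\<close>.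
\<close>

fun ports :: "nat \<Rightarrow> (nat \<times> nat list) list" where
  "ports 0 = map (\<lambda>s. (s, [])) (filter (\<lambda>s. \<not> trivial_state A s) [0..<m])"
| "ports (Suc n) = filter (\<lambda>(s, v). \<not> trivial_state A (section_at A s v))
     (map (\<lambda>((s, v), x). (s, v @ [x])) (List.product (ports n) [0..<k]))"

text \<open>
  The two-colourings of \<open>X\<^sup>n\<close> that are constant on the connected components of the tile graph,
  whose edges \<open>v \<midarrow> s(v)\<close> are those with trivial section of \<open>s\<close> at \<open>v\<close>.
\<close>

definition tile_colouring :: "nat \<Rightarrow> (nat list \<Rightarrow> bool) \<Rightarrow> bool" where
  "tile_colouring n f \<longleftrightarrow> (\<forall>s\<in>states A. \<forall>v\<in>words_of_length A n.
     trivial_state A (section_at A s v) \<longrightarrow> f (transform A s v) = f v)"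

text \<open>A port is an edge from \<open>v\<close> to its image that is not yet imposed. The
  section tells how it continues when a letter is appended; the Booleans are the colours of its
  ends.\<close>

definition port_pattern :: "nat \<Rightarrow> (nat list \<Rightarrow> bool) \<Rightarrow> (nat \<times> bool \<times> bool) list" where
  "port_pattern n f = map (\<lambda>(s, v). (section_at A s v, f v, f (transform A s v))) (ports n)"

text \<open>The two flags mark the constant colourings, which the port values need not
  reveal.\<close>

definition level_code :: "nat \<Rightarrow> ((nat \<times> bool \<times> bool) list \<times> bool \<times> bool) set" where
  "level_code n = (\<lambda>f. (port_pattern n f, \<forall>v\<in>words_of_length A n. f v,
     \<forall>v\<in>words_of_length A n. \<not> f v)) ` Collect (tile_colouring n)"

lemma level_code_iff:
  "(p, a, b) \<in> level_code n \<longleftrightarrow> (\<exists>f. tile_colouring n f \<and> p = port_pattern n f \<and>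
     a = (\<forall>v\<in>words_of_length A n. f v) \<and> b = (\<forall>v\<in>words_of_length A n. \<not> f v))"
  by (auto simp: level_code_def)

lemma set_ports: "set (ports n) = (SIGMA s:states A. active_words A n s)"
proof (induction n)
  case 0
  show ?case by (auto simp: states active_words_def words_of_length_def words_def)
next
  case (Suc n)
  show ?case
  proof (intro equalityI subsetI)
    fix y assume "y \<in> set (ports (Suc n))"
    then obtain s v x where "y = (s, v @ [x])" "(s, v) \<in> set (ports n)" "x < k"
      "\<not> trivial_state A (section_at A s (v @ [x]))"
      by auto
    then show "y \<in> (SIGMA s:states A. active_words A (Suc n) s)"
      by (auto simp: Suc active_words_def words_of_length_Suc_iff letters)
  next
    fix y assume "y \<in> (SIGMA s:states A. active_words A (Suc n) s)"
    then obtain s w where w: "y = (s, w)" "s \<in> states A" "w \<in> words_of_length A (Suc n)"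
      "\<not> trivial_state A (section_at A s w)"
      by (auto simp: active_words_def)
    from w(3) obtain v x where v: "w = v @ [x]" "v \<in> words_of_length A n" "x \<in> letters A"
      by (rule words_of_length_SucE)
    \<comment> \<open>Nontriviality passes to the prefix \<open>v\<close>, so every port of the next
      level extends a port of this one.\<close>
    have "\<not> trivial_state A (section_at A s v)"
    proof
      assume "trivial_state A (section_at A s v)"
      then have "trivial_state A (section_at A (section_at A s v) [x])"
        by (rule trivial_state_section_at) (use v(3) in \<open>simp add: words_def\<close>)
      then show False using w(4) by (simp add: v section_at_append)
    qed
    then have "((s, v), x) \<in> set (List.product (ports n) [0..<k])"
      using v w by (simp add: Suc active_words_def letters)
    then have "(\<lambda>((s, v), x). (s, v @ [x])) ((s, v), x) \<in>
        set (map (\<lambda>((s, v), x). (s, v @ [x])) (List.product (ports n) [0..<k]))"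
      unfolding set_map by (rule imageI)
    then show "y \<in> set (ports (Suc n))"
      using w(1,4) by (simp add: v(1) del: set_map)
  qed
qed

lemma distinct_ports: "distinct (ports n)"
proof (induction n)
  case 0
  show ?case by (auto simp: distinct_map intro: inj_onI)
next
  case (Suc n)
  then show ?case
    by (auto simp: distinct_map intro!: distinct_filter distinct_product inj_onI)
qed

lemma length_ports: "length (ports n) \<le> m * k ^ (2 * m)"
proof -
  have "length (ports n) = card (set (ports n))"
    using distinct_ports by (simp add: distinct_card)
  also have "\<dots> = (\<Sum>s\<in>states A. card (active_words A n s))"
    unfolding set_ports by (intro card_SigmaI)
      (auto simp: states active_words_def letters finite_words_of_length)
  also have "\<dots> \<le> (\<Sum>s\<in>states A. k ^ (2 * m))"
    using card_active_words[OF bd] by (intro sum_mono) (simp add: letters states)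
  also have "\<dots> = m * k ^ (2 * m)" by (simp add: states)
  finally show ?thesis .
qed

text \<open>Full invariance is the tile condition together with equal colours at both ends of every
  port edge, and the latter is visible in the pattern.\<close>

lemma transitive_on_level_iff_level_code:
  "transitive_on_level A n \<longleftrightarrow>
     (\<forall>(p, a, b)\<in>level_code n. (\<forall>(t, y, z)\<in>set p. y = z) \<longrightarrow> a \<or> b)"
proof -
  have "(\<forall>s\<in>states A. \<forall>v\<in>words_of_length A n. f (transform A s v) = f v) \<longleftrightarrow>
      tile_colouring n f \<and> (\<forall>(t, y, z)\<in>set (port_pattern n f). y = z)" for f
  proof -
    have "(\<forall>(t, y, z)\<in>set (port_pattern n f). y = z) \<longleftrightarrow>
        (\<forall>s\<in>states A. \<forall>v\<in>active_words A n s. f v = f (transform A s v))"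
      by (force simp: port_pattern_def set_ports)
    then show ?thesis unfolding tile_colouring_def active_words_def by blast
  qed
  then show ?thesis
    unfolding transitive_on_level_def level_code_def by (simp add: imp_conjL)
qed

text \<open>Splitting by the last letter turns \<open>f\<close> into \<open>k\<close> tile
  colourings of level \<open>i\<close>. Equal codes supply for each one of level \<open>j\<close>
  with the same pattern and flags, and these glue to \<open>h\<close>. The new tile equations and
  the new pattern involve only colours at old ports, so they carry over from
  \<open>f\<close>.\<close>

lemma level_code_Suc_subset:
  assumes eq: "level_code i = level_code j"
  shows "level_code (Suc i) \<subseteq> level_code (Suc j)"
proof
  fix y assume "y \<in> level_code (Suc i)"
  then obtain f where f: "tile_colouring (Suc i) f"
    and y: "y = (port_pattern (Suc i) f, \<forall>v\<in>words_of_length A (Suc i). f v,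
      \<forall>v\<in>words_of_length A (Suc i). \<not> f v)"
    by (auto simp: level_code_def)
  define \<Phi> where "\<Phi> x g \<longleftrightarrow>
      tile_colouring j g \<and> port_pattern i (\<lambda>v. f (v @ [x])) = port_pattern j g \<and>
      (\<forall>v\<in>words_of_length A i. f (v @ [x])) = (\<forall>v\<in>words_of_length A j. g v) \<and>
      (\<forall>v\<in>words_of_length A i. \<not> f (v @ [x])) = (\<forall>v\<in>words_of_length A j. \<not> g v)" for x g
  have "\<exists>g. \<Phi> x g" if x: "x < k" for x
  proof -
    have "tile_colouring i (\<lambda>v. f (v @ [x]))"
      unfolding tile_colouring_def
    proof (intro ballI impI)
      fix s v assume s: "s \<in> states A" and v: "v \<in> words_of_length A i"
        and triv: "trivial_state A (section_at A s v)"
      have vx: "v @ [x] \<in> words_of_length A (Suc i)"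
        using v x by (simp add: words_of_length_Suc_iff letters)
      have xw: "[x] \<in> words A" using x by (simp add: words_def letters)
      have "trivial_state A (section_at A s (v @ [x]))"
        unfolding section_at_append using triv xw by (rule trivial_state_section_at)
      then have "f (transform A s (v @ [x])) = f (v @ [x])"
        using f s vx by (simp add: tile_colouring_def)
      moreover have "transform A s (v @ [x]) = transform A s v @ [x]"
        using triv x by (simp add: transform_snoc_trivial letters)
      ultimately show "f (transform A s v @ [x]) = f (v @ [x])" by simp
    qed
    then have "(port_pattern i (\<lambda>v. f (v @ [x])), \<forall>v\<in>words_of_length A i. f (v @ [x]),
        \<forall>v\<in>words_of_length A i. \<not> f (v @ [x])) \<in> level_code j"
      unfolding eq[symmetric] level_code_iff by blast
    then show ?thesis unfolding \<Phi>_def level_code_iff .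
  qed
  then obtain g where "\<And>x. x < k \<Longrightarrow> \<Phi> x (g x)" by metis
  then have g: "\<And>x. x < k \<Longrightarrow> tile_colouring j (g x)"
    "\<And>x. x < k \<Longrightarrow> port_pattern i (\<lambda>v. f (v @ [x])) = port_pattern j (g x)"
    "\<And>x. x < k \<Longrightarrow> (\<forall>v\<in>words_of_length A i. f (v @ [x])) = (\<forall>v\<in>words_of_length A j. g x v)"
    "\<And>x. x < k \<Longrightarrow> (\<forall>v\<in>words_of_length A i. \<not> f (v @ [x])) = (\<forall>v\<in>words_of_length A j. \<not> g x v)"
    unfolding \<Phi>_def by blast+
  define h where "h w = g (last w) (butlast w)" for w
  have h: "h (v @ [x]) = g x v" for v x by (simp add: h_def)
  \<comment> \<open>\<open>R\<close> compares a port of level \<open>j\<close> with the one of level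
    \<open>i\<close> at the same list position: equal sections, and equal colours at both ends for
    every appended letter.\<close>
  define R where "R p q \<longleftrightarrow> section_at A (fst p) (snd p) = section_at A (fst q) (snd q) \<and>
      (\<forall>x<k. g x (snd p) = f (snd q @ [x]) \<and>
        g x (transform A (fst p) (snd p)) = f (transform A (fst q) (snd q) @ [x]))" for p q
  have k: "0 < k" using fin by (auto simp: finite_automaton_def letters)
  have "length (port_pattern j (g 0)) = length (port_pattern i (\<lambda>v. f (v @ [0])))"
    by (simp only: g(2)[OF k])
  then have len: "length (ports j) = length (ports i)" by (simp add: port_pattern_def)
  have R: "list_all2 R (ports j) (ports i)"
  proof (rule list_all2_all_nthI[OF len])
    fix r assume r: "r < length (ports j)"
    let ?p = "ports j ! r" and ?q = "ports i ! r"
    have "section_at A (fst ?p) (snd ?p) = section_at A (fst ?q) (snd ?q) \<and>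
        g x (snd ?p) = f (snd ?q @ [x]) \<and>
        g x (transform A (fst ?p) (snd ?p)) = f (transform A (fst ?q) (snd ?q) @ [x])"
      if "x < k" for x
    proof -
      have "port_pattern j (g x) ! r = port_pattern i (\<lambda>v. f (v @ [x])) ! r"
        by (simp only: g(2)[OF that])
      then show ?thesis using r len by (simp add: port_pattern_def split_beta)
    qed
    then show "R ?p ?q" unfolding R_def using k by blast
  qed
  have states_ports: "fst p < m" "snd p \<in> words A" if "p \<in> set (ports n)" for p n
    using that by (auto simp: set_ports states active_words_def words_of_length_def)
  have step: "fst (trans A (section_at A s v, x)) < k"
    if "s < m" "v \<in> words A" "x < k" for s v x
    using fst_trans_closed[OF fin, of "section_at A s v" x] section_at_closed[OF fin, of s v] that
    by (simp add: states letters)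
  have tile: "tile_colouring (Suc j) h"
    unfolding tile_colouring_def
  proof (intro ballI impI)
    fix s w assume s: "s \<in> states A" and w: "w \<in> words_of_length A (Suc j)"
      and triv: "trivial_state A (section_at A s w)"
    from w obtain v x where v: "w = v @ [x]" "v \<in> words_of_length A j" "x \<in> letters A"
      by (rule words_of_length_SucE)
    have x: "x < k" using v by (simp add: letters)
    show "h (transform A s w) = h w"
    proof (cases "trivial_state A (section_at A s v)")
      case True
      then have "transform A s w = transform A s v @ [x]"
        unfolding v(1) using v(3) by (rule transform_snoc_trivial)
      then show ?thesis
        using g(1)[OF x] True s v(2) by (simp add: v(1) h tile_colouring_def)
    next
      \<comment> \<open>A new tile edge: the section becomes trivial only after \<open>x\<close>. It
        leads to the copy of \<open>transform A s v\<close> for the output letter \<open>?z\<close>;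
        the tile condition of \<open>f\<close> at the matching port of level \<open>i\<close>
        transfers.\<close>
      case False
      then have "(s, v) \<in> set (ports j)"
        using s v by (simp add: set_ports active_words_def)
      then obtain r where r: "r < length (ports j)" "ports j ! r = (s, v)"
        by (metis in_set_conv_nth)
      obtain s' v' where sv': "ports i ! r = (s', v')" by fastforce
      have "(s', v') \<in> set (ports i)" using r len sv' by (metis nth_mem)
      then have sv'_in: "s' \<in> states A" "v' \<in> words_of_length A i"
        by (auto simp: set_ports active_words_def)
      have "R (s, v) (s', v')" using list_all2_nthD[OF R r(1)] r sv' by simp
      then have R': "section_at A s v = section_at A s' v'"
        "\<And>x. x < k \<Longrightarrow> g x v = f (v' @ [x])"
        "\<And>x. x < k \<Longrightarrow> g x (transform A s v) = f (transform A s' v' @ [x])"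
        by (auto simp: R_def)
      let ?z = "fst (trans A (section_at A s v, x))"
      have z: "?z < k" using step[of s v x] s v x by (simp add: states words_of_length_def)
      have "h (transform A s w) = g ?z (transform A s v)"
        by (simp add: v(1) transform_snoc h)
      also have "\<dots> = f (transform A s' (v' @ [x]))"
        using R'(1,3) z by (simp add: transform_snoc)
      also have "\<dots> = f (v' @ [x])"
      proof -
        have "trivial_state A (section_at A s' (v' @ [x]))"
          using triv R'(1) by (simp add: v(1) section_at_append)
        moreover have "v' @ [x] \<in> words_of_length A (Suc i)"
          using sv'_in v by (simp add: words_of_length_Suc_iff)
        ultimately show ?thesis using f sv'_in by (simp add: tile_colouring_def)
      qed
      also have "\<dots> = h w" using R'(2)[OF x] by (simp add: v(1) h)
      finally show ?thesis .
    qed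
  qed
  have pattern: "port_pattern (Suc j) h = port_pattern (Suc i) f"
  proof -
    let ?ext = "\<lambda>((s, v), x). (s, v @ [x])" and ?Q = "\<lambda>(s, v). \<not> trivial_state A (section_at A s v)"
      and ?F = "\<lambda>f (s, v). (section_at A s v, f v, f (transform A s v))"
    \<comment> \<open>Both candidate lists pair ports with letters in the same order, and matched
      ports have equal sections, so the filter keeps the same positions in both.\<close>
    let ?S = "\<lambda>p q. fst p \<in> set (ports j) \<and> fst q \<in> set (ports i) \<and> R (fst p) (fst q) \<and>
        snd p = snd q \<and> snd q < k"
    have "list_all2 ?S (List.product (ports j) [0..<k]) (List.product (ports i) [0..<k])"
    proof (rule list_all2_all_nthI)
      show "length (List.product (ports j) [0..<k]) = length (List.product (ports i) [0..<k])"
        by (simp add: len)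
      fix r assume r: "r < length (List.product (ports j) [0..<k])"
      then have r': "r < length (ports j) * k" by simp
      then have "r div k < length (ports j)" by (simp add: less_mult_imp_div_less)
      then show "?S (List.product (ports j) [0..<k] ! r) (List.product (ports i) [0..<k] ! r)"
        using r' len k list_all2_nthD[OF R] by (simp add: product_nth)
    qed
    then have "map (?F h \<circ> ?ext) (filter (?Q \<circ> ?ext) (List.product (ports j) [0..<k])) =
        map (?F f \<circ> ?ext) (filter (?Q \<circ> ?ext) (List.product (ports i) [0..<k]))"
    proof (rule map_filter_cong_list_all2)
      fix p q assume S: "?S p q"
      obtain s v x s' v' where p: "p = ((s, v), x)" and q: "q = ((s', v'), x)"
        using S by (metis prod.collapse)
      have "x < k" "s < m" "s' < m" "v \<in> words A" "v' \<in> words A"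
        using S states_ports(1,2) by (fastforce simp: p q)+
      moreover have "R (s, v) (s', v')" using S by (simp add: p q)
      ultimately show "(?Q \<circ> ?ext) p = (?Q \<circ> ?ext) q" "(?F h \<circ> ?ext) p = (?F f \<circ> ?ext) q"
        using step[of s' v' x]
        by (auto simp: p q R_def h section_at_snoc transform_snoc)
    qed
    then show ?thesis by (simp add: port_pattern_def filter_map del: map_map map_eq_conv flip: map_map)
  qed
  have all: "(\<forall>w\<in>words_of_length A (Suc n). P w) \<longleftrightarrow> (\<forall>x<k. \<forall>v\<in>words_of_length A n. P (v @ [x]))"
    for P n
  proof (intro iffI allI impI ballI)
    fix w assume P: "\<forall>x<k. \<forall>v\<in>words_of_length A n. P (v @ [x])" and "w \<in> words_of_length A (Suc n)"
    from this(2) obtain v x where "w = v @ [x]" "v \<in> words_of_length A n" "x \<in> letters A"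
      by (rule words_of_length_SucE)
    then show "P w" using P by (simp add: letters)
  qed (simp add: words_of_length_Suc_iff letters)
  have "(\<forall>w\<in>words_of_length A (Suc i). f w) = (\<forall>w\<in>words_of_length A (Suc j). h w)"
    "(\<forall>w\<in>words_of_length A (Suc i). \<not> f w) = (\<forall>w\<in>words_of_length A (Suc j). \<not> h w)"
    unfolding all h using g(3,4) by blast+
  with tile pattern show "y \<in> level_code (Suc j)"
    unfolding y level_code_iff by metis
qed

text \<open>This makes the sequence of codes a deterministic iteration, so one repetition forces
  periodicity from there on.\<close>

lemma level_code_Suc: "level_code i = level_code j \<Longrightarrow> level_code (Suc i) = level_code (Suc j)"
  using level_code_Suc_subset[of i j] level_code_Suc_subset[of j i] by auto

text \<open>Every code is a subset of the finite set \<open>?U\<close>. A label is one of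
  \<open>m\<close> states with two Booleans, so there are \<open>4 * m\<close> labels;
  \<open>length_ports\<close> bounds the length of a pattern, and the two flags contribute the
  factor 4.\<close>

lemma card_level_codes: "card (range level_code) \<le> level_bound k m" "finite (range level_code)"
proof -
  let ?C = "m * k ^ (2 * m)"
  let ?L = "{l :: (nat \<times> bool \<times> bool) list. set l \<subseteq> {..<m} \<times> UNIV \<and> length l \<le> ?C}"
  let ?U = "?L \<times> (UNIV :: (bool \<times> bool) set)"
  have fL: "finite ?L" by (rule finite_lists_length_le) simp
  have "section_at A s v < m" if "(s, v) \<in> set (ports n)" for s v n
    using section_at_closed[OF fin, of s v] that
    by (auto simp: set_ports states active_words_def words_of_length_def)
  then have sub: "range level_code \<subseteq> Pow ?U"
    using length_ports by (fastforce simp: level_code_def port_pattern_def)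
  have fU: "finite ?U" using fL by simp
  have "card ?L = (\<Sum>i\<le>?C. (4 * m) ^ i)"
    by (subst card_lists_length_le) (auto simp: card_cartesian_product mult.commute UNIV_Times_UNIV[symmetric] simp del: UNIV_Times_UNIV)
  also have "\<dots> \<le> Suc (4 * m) ^ ?C" by (rule sum_power_le)
  finally have "card ?U \<le> 4 * Suc (4 * m) ^ ?C"
    by (simp add: card_cartesian_product UNIV_Times_UNIV[symmetric] del: UNIV_Times_UNIV)
  then have "card (Pow ?U) \<le> level_bound k m"
    using fU by (simp add: card_Pow level_bound_def)
  then show "card (range level_code) \<le> level_bound k m"
    using card_mono[OF _ sub] fU by simp
  show "finite (range level_code)" using sub fU by (meson finite_Pow_iff finite_subset)
qed

lemma level_code_recurs: "\<exists>i\<le>level_bound k m. level_code i = level_code n"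
proof -
  have "card (level_code ` {..level_bound k m}) \<le> card (range level_code)"
    using card_level_codes(2) by (intro card_mono) auto
  then have "card (level_code ` {..level_bound k m}) < card {..level_bound k m}"
    using card_level_codes(1) by simp
  then have "\<not> inj_on level_code {..level_bound k m}" by (rule pigeonhole)
  then obtain i j where ij: "i < j" "j \<le> level_bound k m" "level_code i = level_code j"
    by (metis (no_types, lifting) atMost_iff inj_onI linorder_neqE_nat)
  have shift: "level_code (i + d) = level_code (j + d)" for d
  proof (induction d)
    case (Suc d)
    then show ?case using level_code_Suc[OF Suc.IH] by simp
  qed (simp add: ij)
  show ?thesis
  proof (induction n rule: less_induct)
    case (less n)
    show ?case
    proof (cases "n \<le> level_bound k m")
      case False
      \<comment> \<open>Beyond the bound \<open>n\<close> exceeds \<open>j\<close>, and the level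
        can be lowered by the period \<open>j - i\<close>.\<close>
      then have "level_code n = level_code (i + (n - j))" using shift[of "n - j"] ij by simp
      moreover have "i + (n - j) < n" using False ij by simp
      ultimately show ?thesis using less.IH by metis
    qed auto
  qed
qed

text \<open>Every level shares its code with one up to the bound, and transitivity descends from the
  bound to that one.\<close>

lemma level_transitive_iff_level_bound:
  "level_transitive A \<longleftrightarrow> transitive_on_level A (level_bound k m)"
proof -
  have "level_transitive A \<longleftrightarrow> (\<forall>n. transitive_on_level A n)"
    using bd by (intro level_transitive_iff) (auto simp: bounded_automaton_def)
  moreover have nonempty: "letters A \<noteq> {}" using fin by (auto simp: finite_automaton_def)
  have "transitive_on_level A n" if "transitive_on_level A (level_bound k m)" for n
  proof -
    obtain i where "i \<le> level_bound k m" "level_code i = level_code n"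
      using level_code_recurs by blast
    with that show ?thesis
      using transitive_on_level_le[of A "level_bound k m" i] nonempty
      by (simp add: transitive_on_level_iff_level_code)
  qed
  ultimately show ?thesis by blast
qed

end

subsection \<open>The algorithm\<close>

text \<open>The bound is computable from \<open>k\<close> and \<open>m\<close>, so one program
  serves all automata: it computes the level and tests all its colourings on the table code.\<close>

theorem corollary1p4:
  shows "\<exists>p. \<forall>k m. \<forall>A :: (nat, nat) automaton.
           letters A = {..<k} \<and> states A = {..<m} \<and> bounded_automaton A \<longrightarrow>
           run p (automaton_input k m A) = Some (if level_transitive A then 1 else 0)"
proof -
  have "computable 3 (\<lambda>xs. of_bool
      (colouring_test (xs ! 0) (xs ! 1) (xs ! 2) (level_bound (xs ! 0) (xs ! 1))))"
    unfolding level_bound_def by (intro computable_colouring_test computable_arith) auto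
  then obtain p where p: "\<And>xs. length xs = 3 \<Longrightarrow> run p xs = Some (of_bool
      (colouring_test (xs ! 0) (xs ! 1) (xs ! 2) (level_bound (xs ! 0) (xs ! 1))))"
    unfolding computable_def by blast
  have "run p (automaton_input k m A) = Some (if level_transitive A then 1 else 0)"
    if "letters A = {..<k}" "states A = {..<m}" "bounded_automaton A"
    for k m and A :: "(nat, nat) automaton"
  proof -
    have "automaton_input k m A = [k, m, table_code k m A]"
      by (simp add: automaton_input_def table_code_def)
    then have "run p (automaton_input k m A) =
        Some (of_bool (colouring_test k m (table_code k m A) (level_bound k m)))"
      by (simp add: p)
    also have "colouring_test k m (table_code k m A) (level_bound k m) \<longleftrightarrow> level_transitive A"
      using that colouring_test_correct[of A k m "level_bound k m"]
        level_transitive_iff_level_bound[of A k m]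
      by (simp add: bounded_automaton_def)
    finally show ?thesis by simp
  qed
  then show ?thesis by blast
qed

end
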